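(* Let $\mathcal{S}$ be the $d$-dimensional Sobol' sequence (in base $b=2$), or the $d$-dimensional full Niederreiter sequence in prime power base $b$, with base polynomials $p_1,\dots,p_d$ and $e_j=\deg(p_j)$. Let $G_{u,\boldsymbol{k}}(n)$ denote the gain coefficients of $\mathcal{S}$ in the coarse base $(b^{e_1},\dots,b^{e_d})$. Then the gain coefficients for the coarse scramble are $O(\log d)$; specifically, $$\Gamma_d:=\max_{\emptyset\ne u\subseteq\{1,\dots,d\}}\ \sup_{\boldsymbol{k}\in\mathbb{N}_0^{|u|}}\ \sup_{n\in\mathbb{N}}G_{u,\boldsymbol{k}}(n)\le \mathrm{e}\,\bigl\lceil\log_bd+\log_b\log_b(d+b)+2\bigr\rceil,$$ where $\mathrm{e}=\exp(1)$.
   Context: $\mathbb{N}$ is the set of positive integers, $\mathbb{N}_0=\mathbb{N}\cup\{0\}$, $\chi(A)$ is the indicator of $A$, $\mathbb{F}_b$ is the field with $b$ elements, and $\phi:\{0,\dots,b-1\}\to\mathbb{F}_b$ is a fixed bijection with $\phi(0)=0$. Digital sequence: given matrices $C_1,\dots,C_d\in\mathbb{F}_b^{\infty\times\infty}$, for an integer $k\ge0$ with $b$-adic expansion $k=\sum_{i\ge0}\kappa_ib^i$ let $\vec k=(\phi(\kappa_0),\phi(\kappa_1),\dots)^\top$; the $k$-th point is $\boldsymbol{x}_k=(\psi(C_1\vec k),\dots,\psi(C_d\vec k))\in[0,1)^d$, where $\psi((y_1,y_2,\dots)^\top)=\sum_{i\ge1}\phi^{-1}(y_i)b^{-i}$.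 The sequence $(\boldsymbol{x}_k)_{k\ge0}$ is the digital sequence with generating matrices $C_1,\dots,C_d$. Generalized Niederreiter sequence in prime power base $b$: let $p_1,\dots,p_d\in\mathbb{F}_b[x]$ be monic pairwise coprime (base) polynomials, $e_j=\deg p_j$. For $k\in\mathbb{N}$ and $1\le j\le d$ let $k_j=\lfloor(k-1)/e_j\rfloor$ and let $y_k^{(j)}(x)\in\mathbb{F}_b[x]$ be such that for each $q\in\mathbb{N}$ the residues $y_k^{(j)}\bmod p_j$, for $(q-1)e_j\le k-1<qe_j$, are linearly independent over $\mathbb{F}_b$. Expand $y_k^{(j)}(x)/p_j(x)^{k_j+1}$ as a Laurent series in $\mathbb{F}_b((x^{-1}))$ and let $c^{(j)}_{k,r}$ be its coefficient of $x^{-r}$, $r\in\mathbb{N}$. The generalized Niederreiter sequence is the digital sequence with generating matrices $C_j=(c^{(j)}_{k,r})_{k,r\in\mathbb{N}}$. It is known (Tezuka) that it is a $(0,\boldsymbol{e},d)$-sequence in base $b$, $\boldsymbol{e}=(e_1,\dots,e_d)$: for all $m,r\in\mathbb{N}_0$ and $\boldsymbol{k}\in\mathbb{N}_0^d$ with $\sum_je_jk_j=m$, every interval $\prod_{j=1}^d[a_jb^{-e_jk_j},(a_j+1)b^{-e_jk_j})$ with integers $0\le a_j<b^{e_jk_j}$ contains exactly one of $\boldsymbol{x}_{rb^m},\dots,\boldsymbol{x}_{(r+1)b^m-1}$. The full Niederreiter sequence is the generalized Niederreiter sequence whose base polynomials $p_1,p_2,\dots$ are all the monic irreducible polynomials over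 $\mathbb{F}_b$, ordered by increasing (nondecreasing) degree; its $d$-dimensional version uses $p_1,\dots,p_d$. The Sobol' sequence is regarded as a generalized Niederreiter sequence in base $2$ with $p_1(x)=x$ and $p_2,p_3,\dots$ the primitive polynomials over $\mathbb{F}_2$ in order of nondecreasing degree. Gain coefficients in base $(b_1,\dots,b_d)$ (here $b_j=b^{e_j}$): for $\emptyset\ne u\subseteq\{1,\dots,d\}$, $\boldsymbol{k}=(k_j)_{j\in u}\in\mathbb{N}_0^{|u|}$, $n\in\mathbb{N}$, with $x_{i,j}$ the $j$th coordinate of $\boldsymbol{x}_i$, $$G_{u,\boldsymbol{k}}(n)=\frac1n\prod_{j\in u}(b_j-1)^{-1}\sum_{i=0}^{n-1}\sum_{i'=0}^{n-1}\prod_{j\in u}\Bigl(b_j\chi(\lfloor b_j^{k_j+1}x_{i,j}\rfloor=\lfloor b_j^{k_j+1}x_{i',j}\rfloor)-\chi(\lfloor b_j^{k_j}x_{i,j}\rfloor=\lfloor b_j^{k_j}x_{i',j}\rfloor)\Bigr).$$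
   Formalization: The formal statement assumes in addition that no coordinate of a point has digits ending in infinitely many b-1; for y_k of large degree this can fail, and then the stated (0,e,d)-property (and x_k in [0,1)^d) fails too, e.g. x_1=1 for b=2, p_1=x, y_k=1+x+...+x^(k-1). *)

theory Defs
  imports
    "HOL-Analysis.Analysis"
    "HOL-Computational_Algebra.Computational_Algebra"
    "HOL-Library.Landau_Symbols"
begin

text \<open>
  The field with \<open>b\<close> elements is a type \<open>'a :: {field, finite}\<close> with \<open>b = CARD('a)\<close>.
  Coordinates \<open>j\<close> of points and rows and columns of generating matrices are numbered from 1,
  and the value of a sequence or matrix at index 0 is never used.
\<close>

section \<open>Digital sequences\<close>

definition digit_bijection :: "(nat \<Rightarrow> 'a :: {field, finite}) \<Rightarrow> bool" where
  "digit_bijection \<phi> \<longleftrightarrow> bij_betw \<phi> {..<CARD('a)} UNIV \<and> \<phi> 0 = 0"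

definition digit_vec :: "(nat \<Rightarrow> 'a :: {field, finite}) \<Rightarrow> nat \<Rightarrow> nat \<Rightarrow> 'a" where
  "digit_vec \<phi> k r = \<phi> (k div CARD('a) ^ (r - 1) mod CARD('a))"

text \<open>
  Component \<open>i\<close> of the product of the matrix \<open>C\<close> (\<open>C i r\<close> is the entry in row \<open>i\<close> and
  column \<open>r\<close>) with the digit vector of \<open>k\<close>. The formally infinite sum over \<open>r\<close> stops at
  \<open>r = k\<close>, because \<open>k < b ^ k\<close> makes all later digits of \<open>k\<close> vanish.
\<close>

definition mat_digit_vec ::
  "(nat \<Rightarrow> 'a :: {field, finite}) \<Rightarrow> (nat \<Rightarrow> nat \<Rightarrow> 'a) \<Rightarrow> nat \<Rightarrow> nat \<Rightarrow> 'a" where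
  "mat_digit_vec \<phi> C k i = (\<Sum>r = 1..k. C i r * digit_vec \<phi> k r)"

definition digit_of :: "(nat \<Rightarrow> 'a :: {field, finite}) \<Rightarrow> 'a \<Rightarrow> nat" where
  "digit_of \<phi> = the_inv_into {..<CARD('a)} \<phi>"

definition digit_value :: "(nat \<Rightarrow> 'a :: {field, finite}) \<Rightarrow> (nat \<Rightarrow> 'a) \<Rightarrow> real" where
  "digit_value \<phi> v = (\<Sum>i. real (digit_of \<phi> (v (Suc i))) / real CARD('a) ^ Suc i)"

definition digital_point ::
  "(nat \<Rightarrow> 'a :: {field, finite}) \<Rightarrow> (nat \<Rightarrow> nat \<Rightarrow> nat \<Rightarrow> 'a) \<Rightarrow> nat \<Rightarrow> nat \<Rightarrow> real" where
  "digital_point \<phi> C k j = digit_value \<phi> (mat_digit_vec \<phi> (C j) k)"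

text \<open>
  The usual convention on the generating matrices of a digital sequence: in no coordinate do the
  digits of a point end in an infinite run of \<open>b - 1\<close>. So the digits produced by the matrices
  are the \<open>b\<close>-adic digits of a point of \<open>[0,1)^d\<close>. Without it, \<open>y_k\<close> of large degree in the
  construction below can produce the point 1 and coinciding points, and the
  \<open>(0,e,d)\<close>-sequence property fails. It holds automatically if \<open>degree (y j k) < degree (p j)\<close>.
\<close>

definition regular_digits ::
  "(nat \<Rightarrow> 'a :: {field, finite}) \<Rightarrow> (nat \<Rightarrow> nat \<Rightarrow> nat \<Rightarrow> 'a) \<Rightarrow> nat \<Rightarrow> bool" where
  "regular_digits \<phi> C d \<longleftrightarrow>
     (\<forall>j\<in>{1..d}. \<forall>k. \<exists>\<^sub>\<infinity>i. mat_digit_vec \<phi> (C j) k i \<noteq> \<phi> (CARD('a) - 1))"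


section \<open>Generalized Niederreiter sequences\<close>

text \<open>
  The embedding of polynomials in \<open>x\<close> into the field of Laurent series in \<open>1/x\<close>. The
  indeterminate \<open>fls_X\<close> stands for \<open>1/x\<close>, so \<open>fls_nth f r\<close> is the coefficient of \<open>x^(-r)\<close>.
\<close>

definition laurent_at_infinity :: "'a :: field poly \<Rightarrow> 'a fls" where
  "laurent_at_infinity f = poly (map_poly fls_const f) fls_X_inv"

definition niederreiter_matrix ::
  "(nat \<Rightarrow> 'a :: field poly) \<Rightarrow> (nat \<Rightarrow> nat \<Rightarrow> 'a poly) \<Rightarrow> nat \<Rightarrow> nat \<Rightarrow> nat \<Rightarrow> 'a" where
  "niederreiter_matrix p y j k r =
     fls_nth (laurent_at_infinity (y j k) /
              laurent_at_infinity (p j) ^ ((k - 1) div degree (p j) + 1)) (int r)"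

definition independent_residues :: "'a :: field poly \<Rightarrow> (nat \<Rightarrow> 'a poly) \<Rightarrow> nat set \<Rightarrow> bool" where
  "independent_residues p g K \<longleftrightarrow>
     (\<forall>c. (\<Sum>k\<in>K. smult (c k) (g k mod p)) = 0 \<longrightarrow> (\<forall>k\<in>K. c k = 0))"

definition generalized_niederreiter ::
  "(nat \<Rightarrow> 'a :: {field, finite}) \<Rightarrow> (nat \<Rightarrow> 'a poly) \<Rightarrow> (nat \<Rightarrow> nat \<Rightarrow> 'a poly) \<Rightarrow> nat \<Rightarrow> bool" where
  "generalized_niederreiter \<phi> p y d \<longleftrightarrow>
     digit_bijection \<phi> \<and>
     (\<forall>j\<in>{1..d}. lead_coeff (p j) = 1 \<and> degree (p j) > 0) \<and>
     (\<forall>i\<in>{1..d}. \<forall>j\<in>{1..d}. i \<noteq> j \<longrightarrow> coprime (p i) (p j)) \<and>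
     (\<forall>j\<in>{1..d}. \<forall>q\<ge>1. independent_residues (p j) (y j)
        {k. 1 \<le> k \<and> (q - 1) * degree (p j) \<le> k - 1 \<and> k - 1 < q * degree (p j)}) \<and>
     regular_digits \<phi> (niederreiter_matrix p y) d"

definition niederreiter_point ::
  "(nat \<Rightarrow> 'a :: {field, finite}) \<Rightarrow> (nat \<Rightarrow> 'a poly) \<Rightarrow> (nat \<Rightarrow> nat \<Rightarrow> 'a poly) \<Rightarrow>
     nat \<Rightarrow> nat \<Rightarrow> real" where
  "niederreiter_point \<phi> p y = digital_point \<phi> (niederreiter_matrix p y)"


section \<open>Base polynomials of the full Niederreiter and Sobol' sequences\<close>

definition full_niederreiter_base :: "(nat \<Rightarrow> 'a :: {field, finite} poly) \<Rightarrow> bool" where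
  "full_niederreiter_base p \<longleftrightarrow>
     bij_betw p {1..} {f. lead_coeff f = 1 \<and> irreducible f} \<and>
     (\<forall>i\<ge>1. \<forall>j\<ge>i. degree (p i) \<le> degree (p j))"

text \<open>
  A primitive polynomial is the minimal polynomial of a generator of the multiplicative group of a
  finite extension field. In terms of the extension field \<open>F[x]/(f)\<close>: \<open>f\<close> is monic and
  irreducible, the class of \<open>x\<close> is nonzero, and every nonzero class is one of its powers.
  The condition on the class of \<open>x\<close> is not redundant: over the field with two elements the
  polynomial \<open>x\<close> satisfies the others.
\<close>

definition primitive_polynomial :: "'a :: {field, finite} poly \<Rightarrow> bool" where
  "primitive_polynomial f \<longleftrightarrow>
     lead_coeff f = 1 \<and> irreducible f \<and> \<not> f dvd [:0, 1:] \<and>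
     (\<forall>g. \<not> f dvd g \<longrightarrow> (\<exists>n. [:0, 1:] ^ n mod f = g mod f))"

definition sobol_base :: "(nat \<Rightarrow> 'a :: {field, finite} poly) \<Rightarrow> bool" where
  "sobol_base p \<longleftrightarrow>
     CARD('a) = 2 \<and> p 1 = [:0, 1:] \<and>
     bij_betw p {2..} {f. primitive_polynomial f} \<and>
     (\<forall>i\<ge>2. \<forall>j\<ge>i. degree (p i) \<le> degree (p j))"


section \<open>Gain coefficients\<close>

definition gain ::
  "(nat \<Rightarrow> nat) \<Rightarrow> (nat \<Rightarrow> nat \<Rightarrow> real) \<Rightarrow> nat set \<Rightarrow> (nat \<Rightarrow> nat) \<Rightarrow> nat \<Rightarrow> real" where
  "gain B x u k n =
     1 / real n * (\<Prod>j\<in>u. inverse (real (B j) - 1)) *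
     (\<Sum>i<n. \<Sum>i'<n. \<Prod>j\<in>u.
        real (B j) *
          of_bool (\<lfloor>real (B j) ^ (k j + 1) * x i j\<rfloor> = \<lfloor>real (B j) ^ (k j + 1) * x i' j\<rfloor>) -
        of_bool (\<lfloor>real (B j) ^ k j * x i j\<rfloor> = \<lfloor>real (B j) ^ k j * x i' j\<rfloor>))"

text \<open>
  The supremum is taken in the extended reals, so that a bound on it includes its finiteness.
  Only the values of \<open>k\<close> on \<open>u\<close> enter \<open>gain\<close>, so \<open>k\<close> ranges over all functions.
\<close>

definition max_gain :: "(nat \<Rightarrow> nat) \<Rightarrow> (nat \<Rightarrow> nat \<Rightarrow> real) \<Rightarrow> nat \<Rightarrow> ereal" where
  "max_gain B x d =
     Max ((\<lambda>u. SUP k. SUP n\<in>{1..}. ereal (gain B x u k n)) ` {u. u \<noteq> {} \<and> u \<subseteq> {1..d}})"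

definition niederreiter_max_gain ::
  "(nat \<Rightarrow> 'a :: {field, finite}) \<Rightarrow> (nat \<Rightarrow> 'a poly) \<Rightarrow> (nat \<Rightarrow> nat \<Rightarrow> 'a poly) \<Rightarrow> nat \<Rightarrow> ereal" where
  "niederreiter_max_gain \<phi> p y d =
     max_gain (\<lambda>j. CARD('a) ^ degree (p j)) (niederreiter_point \<phi> p y) d"

end

theory Submission
  imports Defs "HOL-Real_Asymp.Real_Asymp"
begin

text \<open>
  Write \<open>b\<^sub>j = b ^ e\<^sub>j\<close>, and for two indices \<open>i, i'\<close> let \<open>[f\<^sub>j]\<close> and \<open>[g\<^sub>j]\<close> be the indicators that
  the \<open>j\<close>-th coordinates of their points lie in the same fine cell (of length \<open>1 / b\<^sub>j ^ (k\<^sub>j + 1)\<close>)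
  and in the same coarse cell (of length \<open>1 / b\<^sub>j ^ k\<^sub>j\<close>). Up to normalisation the gain coefficient
  is the sum over all pairs of indices of the kernel \<open>\<Prod>j\<in>u. b\<^sub>j * [f\<^sub>j] - [g\<^sub>j]\<close>.

  Each factor \<open>b\<^sub>j * [f\<^sub>j] - [g\<^sub>j]\<close> is positive semidefinite, and so is \<open>[g\<^sub>j]\<close>. By Schur's product theorem,
  all terms in the expansion of \<open>\<Prod>j\<in>u. ((b\<^sub>j * [f\<^sub>j] - [g\<^sub>j]) + [g\<^sub>j])\<close> are positive
  semidefinite. Keeping the two extreme terms shows that the gain sum is at most
  \<open>\<Prod>j\<in>u. b\<^sub>j\<close> times the number of pairs in a common fine box, minus the number of
  pairs in a common coarse box (\<open>refinement_kernel_sum_bounds\<close>). If each aligned block of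
  \<open>\<Prod>j\<in>u. b\<^sub>j ^ (k\<^sub>j + 1)\<close> indices puts at most one point into each fine box, then counting pairs gives the
  gain bound \<open>\<Prod>j\<in>u. b\<^sub>j / (b\<^sub>j - 1)\<close> (\<open>gain_le_prod\<close>).

  Niederreiter sequences have this distribution property by an argument of Tezuka. The
  difference of the digit vectors of two indices in the same block that share a fine
  box is annihilated by a square submatrix of the generating matrices. A dependence between
  its rows makes a sum of partial fractions with denominators \<open>p\<^sub>j ^ l\<close> a
  polynomial, which forces all coefficients to vanish (\<open>rows_independent\<close>). So the submatrix
  is regular and the indices coincide.

  It remains to bound \<open>\<Prod>j. (1 - b ^ (- e\<^sub>j)) ^ (- 1)\<close>, a partial Euler product of the zeta function of
  the polynomial ring, over \<open>d\<close> distinct monic irreducible polynomials. Since at most \<open>b\<close> of these have degree 1 and at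
  most \<open>(b ^ e - b) / e\<close> of them have degree \<open>e \<ge> 2\<close>, the polynomials of degree at most \<open>N\<close>
  contribute a factor growing like \<open>exp (1/2 + 1/3 + \<dots> + 1/N)\<close>, hence linear in \<open>N\<close>. If \<open>N\<close> is a
  little larger than \<open>log b d\<close>, then the at most \<open>d\<close> polynomials of larger degree hardly matter.
  For \<open>N\<close> the rounded logarithmic expression in the theorem, the constants work out to
  \<open>exp 1 * N\<close> (\<open>prod_irreducibles_le_log\<close>). Both the full Niederreiter and the Sobol' sequence have distinct
  irreducible base polynomials.
\<close>

section \<open>Positive semidefinite kernels of nested partitions\<close>

text \<open>
  Quantifying over all weights \<open>w\<close>, instead of asking for a nonnegative total sum of the kernel,
  makes the property stable under multiplication of the kernel by \<open>h i * h i'\<close>.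
\<close>

definition psd_kernel :: "'i set \<Rightarrow> ('i \<Rightarrow> 'i \<Rightarrow> real) \<Rightarrow> bool" where
  "psd_kernel I K \<longleftrightarrow> (\<forall>w. (\<Sum>i\<in>I. \<Sum>i'\<in>I. w i * w i' * K i i') \<ge> 0)"

text \<open>
  Kernels that are inner products of feature vectors. Features are numbered by integers because
  they correspond to the cells of a coordinate.
\<close>

definition gram_kernel :: "'i set \<Rightarrow> ('i \<Rightarrow> 'i \<Rightarrow> real) \<Rightarrow> bool" where
  "gram_kernel I K \<longleftrightarrow>
     (\<exists>(C :: int set) h. finite C \<and> (\<forall>i\<in>I. \<forall>i'\<in>I. K i i' = (\<Sum>c\<in>C. h c i * h c i')))"

lemma psd_kernel_const: "0 \<le> a \<Longrightarrow> psd_kernel I (\<lambda>_ _. a)"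
  unfolding psd_kernel_def
proof
  fix w :: "'a \<Rightarrow> real"
  assume "0 \<le> a"
  have "(\<Sum>i\<in>I. \<Sum>i'\<in>I. w i * w i' * a) = (\<Sum>i\<in>I. w i)\<^sup>2 * a"
    unfolding power2_eq_square sum_product by (simp only: sum_distrib_right)
  then show "(\<Sum>i\<in>I. \<Sum>i'\<in>I. w i * w i' * a) \<ge> 0" using \<open>0 \<le> a\<close> by simp
qed

text \<open>
  Schur's product theorem, in the easy case in which one factor is given by its features \<open>h c\<close>:
  replace the weights \<open>w\<close> by \<open>w * h c\<close> and sum over \<open>c\<close>.
\<close>

lemma psd_kernel_mult_gram:
  assumes K: "psd_kernel I K" and H: "gram_kernel I H"
  shows "psd_kernel I (\<lambda>i i'. K i i' * H i i')"
  unfolding psd_kernel_def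
proof
  fix w :: "'a \<Rightarrow> real"
  obtain C :: "int set" and h where C: "finite C"
    and h: "\<And>i i'. i \<in> I \<Longrightarrow> i' \<in> I \<Longrightarrow> H i i' = (\<Sum>c\<in>C. h c i * h c i')"
    using H unfolding gram_kernel_def by blast
  have "(\<Sum>i\<in>I. \<Sum>i'\<in>I. w i * w i' * (K i i' * H i i')) =
        (\<Sum>i\<in>I. \<Sum>i'\<in>I. \<Sum>c\<in>C. (w i * h c i) * (w i' * h c i') * K i i')"
    by (intro sum.cong refl) (simp add: h sum_distrib_left mult_ac)
  also have "\<dots> = (\<Sum>i\<in>I. \<Sum>c\<in>C. \<Sum>i'\<in>I. (w i * h c i) * (w i' * h c i') * K i i')"
    by (intro sum.cong refl sum.swap)
  also have "\<dots> = (\<Sum>c\<in>C. \<Sum>i\<in>I. \<Sum>i'\<in>I. (w i * h c i) * (w i' * h c i') * K i i')"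
    by (rule sum.swap)
  also have "\<dots> \<ge> 0"
  proof (rule sum_nonneg)
    fix c
    show "(\<Sum>i\<in>I. \<Sum>i'\<in>I. (w i * h c i) * (w i' * h c i') * K i i') \<ge> 0"
      using K[unfolded psd_kernel_def, rule_format, of "\<lambda>i. w i * h c i"] by simp
  qed
  finally show "(\<Sum>i\<in>I. \<Sum>i'\<in>I. w i * w i' * (K i i' * H i i')) \<ge> 0" .
qed

lemma psd_kernel_prod_gram:
  assumes "finite u" and "\<And>j. j \<in> u \<Longrightarrow> gram_kernel I (H j)"
  shows "psd_kernel I (\<lambda>i i'. \<Prod>j\<in>u. H j i i')"
  using assms
proof (induction u rule: finite_induct)
  case empty
  show ?case using psd_kernel_const[of 1 I] by simp
next
  case (insert j u)
  have "psd_kernel I (\<lambda>i i'. (\<Prod>j\<in>u. H j i i') * H j i i')"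
    by (intro psd_kernel_mult_gram) (use insert in auto)
  then show ?case using insert by (simp add: mult.commute)
qed

lemma sum_of_bool_mult_delta:
  fixes f :: "'c \<Rightarrow> real"
  assumes "finite C" "a \<in> C"
  shows "(\<Sum>c\<in>C. of_bool (a = c) * f c) = f a"
proof -
  have "(\<Sum>c\<in>C. of_bool (a = c) * f c) = (\<Sum>c\<in>C. if a = c then f c else 0)"
    by (intro sum.cong) auto
  then show ?thesis using assms by (simp add: sum.delta')
qed

lemma gram_kernel_same_cell:
  assumes "finite I"
  shows "gram_kernel I (\<lambda>i i'. of_bool (a i = (a i' :: int)))"
proof -
  have same: "of_bool (a i = a i') = (\<Sum>c\<in>a ` I. of_bool (a i = c) * of_bool (a i' = c) :: real)"
    if "i \<in> I" for i i'
  proof -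
    have "(\<Sum>c\<in>a ` I. of_bool (a i = c) * of_bool (a i' = c) :: real) = of_bool (a i' = a i)"
      by (rule sum_of_bool_mult_delta) (use assms that in blast)+
    also have "\<dots> = of_bool (a i = a i')" by (rule arg_cong[of _ _ of_bool]) (rule eq_commute)
    finally show ?thesis by (rule sym)
  qed
  show ?thesis unfolding gram_kernel_def
    by (intro exI[of _ "a ` I"] exI[of _ "\<lambda>c i. of_bool (a i = c)"] conjI ballI
          finite_imageI assms same)
qed

lemma interval_div_iff:
  assumes "B > (0 :: nat)"
  shows "c \<in> {q * int B ..< q * int B + int B} \<longleftrightarrow> q = c div int B"
proof
  assume "c \<in> {q * int B ..< q * int B + int B}"
  then have "c = q * int B + (c - q * int B)" "0 \<le> c - q * int B" "c - q * int B < int B" by auto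
  then show "q = c div int B"
    by (intro int_div_pos_eq[symmetric]) auto
next
  assume "q = c div int B"
  then have "q * int B = c - c mod int B" by (simp add: minus_mod_eq_div_mult)
  then show "c \<in> {q * int B ..< q * int B + int B}"
    using assms by simp
qed

text \<open>
  Let \<open>a i\<close> be the fine cell and \<open>a i div B\<close> the coarse cell of \<open>i\<close>. On the space spanned by the
  \<open>B\<close> children of one coarse cell the kernel is \<open>B\<close> times the identity minus the all-ones matrix,
  which is \<open>B\<close> times a projection. A projection is its own Gram matrix, so its columns, rescaled,
  serve as features. The set \<open>C\<close> must contain all children of every coarse cell that occurs,
  whether or not they are hit.
\<close>

lemma gram_kernel_refinement:
  assumes "finite I" and B: "B > 0"
  shows "gram_kernel I (\<lambda>i i'. real B * of_bool (a i = a i') -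
           of_bool (a i div int B = a i' div int B))"
proof -
  define C where "C = (\<Union>i\<in>I. {a i div int B * int B ..< a i div int B * int B + int B})"
  define h where "h = (\<lambda>c i. (real B * of_bool (a i = c) - of_bool (a i div int B = c div int B))
                        / sqrt (real B))"
  have fin: "finite C" using assms by (auto simp: C_def)
  have mem: "c \<in> C \<longleftrightarrow> (\<exists>i\<in>I. a i div int B = c div int B)" for c
    unfolding C_def using interval_div_iff[OF B] by blast
  have cell_mem: "a i \<in> C" if "i \<in> I" for i using that mem by blast
  have siblings: "(\<Sum>c\<in>C. of_bool (a i div int B = c div int B)) = real B" if "i \<in> I" for i
  proof -
    have "(\<Sum>c\<in>C. of_bool (a i div int B = c div int B)) =
            real (card {c \<in> C. a i div int B = c div int B})"
      using fin by (simp add: sum.If_cases of_bool_def Int_def)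
    also have "{c \<in> C. a i div int B = c div int B} =
                 {a i div int B * int B ..< a i div int B * int B + int B}"
      using mem that interval_div_iff[OF B] by blast
    finally show ?thesis by simp
  qed
  have "real B * of_bool (a i = a i') - of_bool (a i div int B = a i' div int B) =
        (\<Sum>c\<in>C. h c i * h c i')" if i: "i \<in> I" "i' \<in> I" for i i'
  proof -
    let ?e = "\<lambda>i c. of_bool (a i = c) :: real"
    let ?s = "\<lambda>i c. of_bool (a i div int B = c div int B) :: real"
    have "(\<Sum>c\<in>C. h c i * h c i') =
          (\<Sum>c\<in>C. (real B)\<^sup>2 * (?e i c * ?e i' c) - real B * (?e i c * ?s i' c)
             - real B * (?e i' c * ?s i c) + ?s i c * ?s i' c) / real B"
      unfolding h_def sum_divide_distrib
      by (intro sum.cong refl) (use B in \<open>simp add: field_simps power2_eq_square\<close>)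
    also have "(\<Sum>c\<in>C. (real B)\<^sup>2 * (?e i c * ?e i' c) - real B * (?e i c * ?s i' c)
             - real B * (?e i' c * ?s i c) + ?s i c * ?s i' c) =
          (real B)\<^sup>2 * (\<Sum>c\<in>C. ?e i c * ?e i' c) - real B * (\<Sum>c\<in>C. ?e i c * ?s i' c)
             - real B * (\<Sum>c\<in>C. ?e i' c * ?s i c) + (\<Sum>c\<in>C. ?s i c * ?s i' c)"
      by (simp add: sum.distrib sum_subtractf sum_distrib_left)
    also have "(\<Sum>c\<in>C. ?e i c * ?e i' c) = of_bool (a i = a i')"
      by (rule trans[OF sum_of_bool_mult_delta[OF fin, of "a i" "?e i'", OF cell_mem[OF i(1)]]]) auto
    also have "(\<Sum>c\<in>C. ?e i c * ?s i' c) = ?s i (a i')"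
      by (rule trans[OF sum_of_bool_mult_delta[OF fin, of "a i" "?s i'", OF cell_mem[OF i(1)]]]) auto
    also have "(\<Sum>c\<in>C. ?e i' c * ?s i c) = ?s i (a i')"
      by (rule sum_of_bool_mult_delta[OF fin, of "a i'" "?s i", OF cell_mem[OF i(2)]])
    also have "(\<Sum>c\<in>C. ?s i c * ?s i' c) = ?s i (a i') * real B"
    proof -
      have "(\<Sum>c\<in>C. ?s i c * ?s i' c) = ?s i (a i') * (\<Sum>c\<in>C. ?s i c)"
        unfolding sum_distrib_left by (intro sum.cong) auto
      then show ?thesis using siblings i by simp
    qed
    also have "((real B)\<^sup>2 * e - real B * s - real B * s + s * real B) / real B = real B * e - s" for e s
      using B by (simp add: field_simps power2_eq_square)
    finally show ?thesis by simp
  qed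
  then show ?thesis unfolding gram_kernel_def using fin
    by (intro exI[of _ C] exI[of _ h] conjI ballI) simp_all
qed

text \<open>
  Expand the product of \<open>B j * [f] = (B j * [f] - [g]) + [g]\<close> over \<open>j\<close>, where \<open>[f]\<close> and \<open>[g]\<close> are
  the indicators of equal fine and equal coarse cells. Every term of the expansion is a product
  of Gram kernels, so it contributes a nonnegative sum. The term in which all factors are
  \<open>B j * [f] - [g]\<close> is the sum \<open>S\<close>, the term in which all factors are \<open>[g]\<close> is the sum that is
  subtracted, and these two are different terms because \<open>u\<close> is nonempty.
\<close>

lemma refinement_kernel_sum_bounds:
  fixes f :: "'j \<Rightarrow> 'i \<Rightarrow> int"
  assumes I: "finite I" and u: "finite u" "u \<noteq> {}" and B: "\<And>j. j \<in> u \<Longrightarrow> B j > 0"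
    and g: "\<And>j i. j \<in> u \<Longrightarrow> i \<in> I \<Longrightarrow> g j i = f j i div int (B j)"
  defines "S \<equiv> (\<Sum>i\<in>I. \<Sum>i'\<in>I. \<Prod>j\<in>u.
      real (B j) * of_bool (f j i = f j i') - of_bool (g j i = g j i'))"
  shows "S \<ge> 0"
    and "S \<le> (\<Prod>j\<in>u. real (B j)) * (\<Sum>i\<in>I. \<Sum>i'\<in>I. of_bool (\<forall>j\<in>u. f j i = f j i')) -
             (\<Sum>i\<in>I. \<Sum>i'\<in>I. of_bool (\<forall>j\<in>u. g j i = g j i'))"
proof -
  define D where "D = (\<lambda>j i i'. real (B j) * of_bool (f j i = f j i') - of_bool (g j i = g j i'))"
  define E where "E = (\<lambda>j i i'. of_bool (g j i = g j i') :: real)"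
  define T where "T = (\<lambda>v. \<Sum>i\<in>I. \<Sum>i'\<in>I. (\<Prod>j\<in>v. D j i i') * (\<Prod>j\<in>u - v. E j i i'))"
  have gram_D: "gram_kernel I (D j)" if "j \<in> u" for j
  proof -
    have "gram_kernel I (\<lambda>i i'. real (B j) * of_bool (f j i = f j i') -
           of_bool (f j i div int (B j) = f j i' div int (B j)))"
      by (rule gram_kernel_refinement) (use I B that in auto)
    then show ?thesis using that by (simp add: gram_kernel_def D_def g)
  qed
  have T_nonneg: "T v \<ge> 0" if "v \<subseteq> u" for v
  proof -
    have "psd_kernel I (\<lambda>i i'. \<Prod>j\<in>u. (if j \<in> v then D j else E j) i i')"
      using gram_D gram_kernel_same_cell[OF I] by (intro psd_kernel_prod_gram u) (auto simp: E_def)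
    moreover have "(\<Prod>j\<in>u. (if j \<in> v then D j else E j) i i') =
                   (\<Prod>j\<in>v. D j i i') * (\<Prod>j\<in>u - v. E j i i')" for i i'
    proof -
      have "(\<Prod>j\<in>u. (if j \<in> v then D j else E j) i i') = (\<Prod>j\<in>u. if j \<in> v then D j i i' else E j i i')"
        by (intro prod.cong) auto
      then show ?thesis using u that
        by (simp add: prod.If_cases Int_absorb1 Int_commute Diff_eq)
    qed
    ultimately have "psd_kernel I (\<lambda>i i'. (\<Prod>j\<in>v. D j i i') * (\<Prod>j\<in>u - v. E j i i'))" by simp
    from this[unfolded psd_kernel_def, rule_format, of "\<lambda>_. 1"] show ?thesis by (simp add: T_def)
  qed
  have S: "S = T u" by (simp add: S_def T_def D_def)
  show "S \<ge> 0" unfolding S by (rule T_nonneg) simp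
  have prod_of_bool: "(\<Prod>j\<in>u. of_bool (P j)) = (of_bool (\<forall>j\<in>u. P j) :: real)" for P
    using u(1) by (induction u rule: finite_induct) auto
  have "(\<Prod>j\<in>u. real (B j)) * (\<Sum>i\<in>I. \<Sum>i'\<in>I. of_bool (\<forall>j\<in>u. f j i = f j i')) =
        (\<Sum>i\<in>I. \<Sum>i'\<in>I. \<Prod>j\<in>u. D j i i' + E j i i')"
    unfolding D_def E_def by (simp add: prod.distrib prod_of_bool sum_distrib_left)
  also have "\<dots> = (\<Sum>i\<in>I. \<Sum>i'\<in>I. \<Sum>v\<in>Pow u. (\<Prod>j\<in>v. D j i i') * (\<Prod>j\<in>u - v. E j i i'))"
    using u by (simp add: prod_add)
  also have "\<dots> = (\<Sum>i\<in>I. \<Sum>v\<in>Pow u. \<Sum>i'\<in>I. (\<Prod>j\<in>v. D j i i') * (\<Prod>j\<in>u - v. E j i i'))"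
    by (intro sum.cong refl sum.swap)
  also have "\<dots> = (\<Sum>v\<in>Pow u. T v)" unfolding T_def by (rule sum.swap)
  also have "\<dots> \<ge> (\<Sum>v\<in>{u, {}}. T v)"
    by (intro sum_mono2) (use u T_nonneg in auto)
  also have "(\<Sum>v\<in>{u, {}}. T v) = T u + T {}" using u by simp
  also have "T {} = (\<Sum>i\<in>I. \<Sum>i'\<in>I. of_bool (\<forall>j\<in>u. g j i = g j i'))"
    by (simp add: T_def E_def prod_of_bool)
  finally show "S \<le> (\<Prod>j\<in>u. real (B j)) * (\<Sum>i\<in>I. \<Sum>i'\<in>I. of_bool (\<forall>j\<in>u. f j i = f j i')) -
             (\<Sum>i\<in>I. \<Sum>i'\<in>I. of_bool (\<forall>j\<in>u. g j i = g j i'))"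
    unfolding S by simp
qed

section \<open>A bound on gain coefficients\<close>

lemma coarse_cell_div:
  assumes "B > (0::nat)"
  shows "\<lfloor>real B ^ k * x\<rfloor> = \<lfloor>real B ^ (k + 1) * x\<rfloor> div int B"
proof -
  have "real B ^ k * x = real B ^ (k + 1) * x / real_of_int (int B)" using assms by simp
  then show ?thesis using floor_divide_real_eq_div[of "int B" "real B ^ (k + 1) * x"] assms by simp
qed

text \<open>
  The normalising product is nonnegative, and the double sum is a value of a positive
  semidefinite quadratic form.
\<close>

lemma gain_nonneg:
  assumes "finite u" "u \<noteq> {}" and "\<And>j. j \<in> u \<Longrightarrow> B j \<ge> 2"
  shows "gain B x u k n \<ge> 0"
proof -
  have pos: "B j > 0" if "j \<in> u" for j using assms(3)[OF that] by simp
  have "inverse (real (B j) - 1) \<ge> 0" if "j \<in> u" for j using assms(3)[OF that] by simp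
  then have "(\<Prod>j\<in>u. inverse (real (B j) - 1)) \<ge> 0" by (intro prod_nonneg) auto
  then show ?thesis unfolding gain_def
    by (intro mult_nonneg_nonneg refinement_kernel_sum_bounds(1) assms(1,2) pos coarse_cell_div) auto
qed

lemma card_le_if_inj_on_blocks:
  fixes n L :: nat
  assumes L: "L > 0" and A: "A \<subseteq> {..<n}"
    and inj: "\<And>i i'. i \<in> A \<Longrightarrow> i' \<in> A \<Longrightarrow> i div L = i' div L \<Longrightarrow> i = i'"
  shows "real (card A) \<le> real n / real L + 1"
proof -
  have "card A = card ((\<lambda>i. i div L) ` A)"
    by (rule card_image[symmetric]) (use inj in \<open>auto simp: inj_on_def\<close>)
  also have "\<dots> \<le> card {..n div L}"
    by (rule card_mono) (use A in \<open>auto intro!: div_le_mono dest: subsetD\<close>)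
  finally have "real (card A) \<le> real (n div L) + 1" by simp
  also have "real (n div L) \<le> real n / real L" by (rule of_nat_div_le_of_nat)
  finally show ?thesis by simp
qed

lemma sum_pairs_same_value:
  assumes "finite I"
  shows "(\<Sum>i\<in>I. \<Sum>i'\<in>I. of_bool (h i = h i')) =
         (\<Sum>c\<in>h ` I. (real (card {i \<in> I. h i = c}))\<^sup>2)"
proof -
  have inner: "(\<Sum>i'\<in>I. of_bool (h i = h i')) = real (card {i' \<in> I. h i' = h i})" for i
    using assms by (simp add: of_bool_def sum.If_cases Int_def eq_commute)
  have "(\<Sum>i\<in>I. \<Sum>i'\<in>I. of_bool (h i = h i')) = (\<Sum>i\<in>I. real (card {i' \<in> I. h i' = h i}))"
    by (simp only: inner)
  also have "\<dots> = (\<Sum>c\<in>h ` I. \<Sum>i\<in>{i \<in> I. h i = c}. real (card {i' \<in> I. h i' = h i}))"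
    by (rule sum.image_gen[OF assms])
  also have "\<dots> = (\<Sum>c\<in>h ` I. (real (card {i \<in> I. h i = c}))\<^sup>2)"
    by (intro sum.cong refl) (simp add: power2_eq_square)
  finally show ?thesis .
qed

text \<open>
  The gain bound for every point sequence that puts at most one point of each aligned block of
  \<open>L\<close> consecutive indices into a fine box, where \<open>L\<close> is the number of fine boxes. A point then shares
  its fine box with at most \<open>n / L + 1\<close> of the first \<open>n\<close> points. The Cauchy--Schwarz inequality
  over the \<open>M\<close> coarse boxes shows that at least \<open>n\<^sup>2 / M\<close> pairs share a coarse box. Since
  \<open>L = M * (\<Prod>j\<in>u. B j)\<close>, the terms of order \<open>n\<^sup>2\<close> cancel.
\<close>

lemma gain_le_prod:
  fixes x :: "nat \<Rightarrow> nat \<Rightarrow> real"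
  assumes u: "finite u" "u \<noteq> {}" and B: "\<And>j. j \<in> u \<Longrightarrow> B j \<ge> 2" and n: "n > 0"
    and unit: "\<And>i j. j \<in> u \<Longrightarrow> 0 \<le> x i j \<and> x i j < 1"
    and blocks: "\<And>i i'. i div (\<Prod>j\<in>u. B j ^ (k j + 1)) = i' div (\<Prod>j\<in>u. B j ^ (k j + 1)) \<Longrightarrow>
      (\<And>j. j \<in> u \<Longrightarrow> \<lfloor>real (B j) ^ (k j + 1) * x i j\<rfloor> = \<lfloor>real (B j) ^ (k j + 1) * x i' j\<rfloor>) \<Longrightarrow>
      i = i'"
  shows "gain B x u k n \<le> (\<Prod>j\<in>u. real (B j) / (real (B j) - 1))"
proof -
  define f where "f = (\<lambda>j i. \<lfloor>real (B j) ^ (k j + 1) * x i j\<rfloor>)"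
  define g where "g = (\<lambda>j i. \<lfloor>real (B j) ^ k j * x i j\<rfloor>)"
  define L where "L = (\<Prod>j\<in>u. B j ^ (k j + 1))"
  define M where "M = (\<Prod>j\<in>u. B j ^ k j)"
  define S where "S = (\<Sum>i\<in>{..<n}. \<Sum>i'\<in>{..<n}. \<Prod>j\<in>u.
      real (B j) * of_bool (f j i = f j i') - of_bool (g j i = g j i'))"
  have pos: "B j > 0" if "j \<in> u" for j using B[OF that] by simp
  have Lpos: "L > 0" and Mpos: "M > 0" unfolding L_def M_def by (auto intro!: prod_pos pos)
  have LM: "real L = real M * (\<Prod>j\<in>u. real (B j))"
    by (simp add: L_def M_def mult.commute flip: prod.distrib)
  have fine: "(\<Sum>i\<in>{..<n}. \<Sum>i'\<in>{..<n}. of_bool (\<forall>j\<in>u. f j i = f j i')) \<le>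
                real n * (real n / real L + 1)"
  proof -
    have "(\<Sum>i'\<in>{..<n}. of_bool (\<forall>j\<in>u. f j i = f j i')) \<le> real n / real L + 1" for i
    proof -
      have "(\<Sum>i'\<in>{..<n}. of_bool (\<forall>j\<in>u. f j i = f j i')) =
              real (card {i' \<in> {..<n}. \<forall>j\<in>u. f j i = f j i'})"
        by (simp add: of_bool_def sum.If_cases Int_def)
      also have "\<dots> \<le> real n / real L + 1"
      proof (rule card_le_if_inj_on_blocks[OF Lpos])
        fix i1 i2
        assume "i1 \<in> {i' \<in> {..<n}. \<forall>j\<in>u. f j i = f j i'}" "i2 \<in> {i' \<in> {..<n}. \<forall>j\<in>u. f j i = f j i'}"
          and "i1 div L = i2 div L"
        then show "i1 = i2" by (intro blocks[of i1 i2]) (auto simp: L_def f_def)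
      qed auto
      finally show ?thesis .
    qed
    then have "(\<Sum>i\<in>{..<n}. \<Sum>i'\<in>{..<n}. of_bool (\<forall>j\<in>u. f j i = f j i')) \<le>
                 (\<Sum>i\<in>{..<n}. real n / real L + 1)"
      by (intro sum_mono) auto
    then show ?thesis by simp
  qed
  have coarse: "(real n)\<^sup>2 / real M \<le> (\<Sum>i\<in>{..<n}. \<Sum>i'\<in>{..<n}. of_bool (\<forall>j\<in>u. g j i = g j i'))"
  proof -
    define h where "h = (\<lambda>i. restrict (\<lambda>j. g j i) u)"
    have h: "(\<forall>j\<in>u. g j i = g j i') \<longleftrightarrow> h i = h i'" for i i'
      by (auto simp: h_def restrict_def fun_eq_iff)
    have "h ` {..<n} \<subseteq> PiE u (\<lambda>j. {0..<int (B j ^ k j)})"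
    proof (rule image_subsetI)
      fix i
      have "g j i \<in> {0..<int (B j ^ k j)}" if "j \<in> u" for j
        using unit[OF that, of i] pos[OF that] by (auto simp: g_def floor_less_iff)
      then show "h i \<in> PiE u (\<lambda>j. {0..<int (B j ^ k j)})" by (auto simp: h_def)
    qed
    then have "card (h ` {..<n}) \<le> card (PiE u (\<lambda>j. {0..<int (B j ^ k j)}))"
      by (intro card_mono finite_PiE u) auto
    also have "\<dots> = M" unfolding M_def using u by (simp add: card_PiE flip: of_nat_power)
    finally have card_h: "card (h ` {..<n}) \<le> M" .
    have "real n = (\<Sum>i\<in>{..<n}. 1)" by simp
    also have "\<dots> = (\<Sum>c\<in>h ` {..<n}. \<Sum>i\<in>{i \<in> {..<n}. h i = c}. 1)"
      by (rule sum.image_gen) simp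
    also have "\<dots> = (\<Sum>c\<in>h ` {..<n}. real (card {i \<in> {..<n}. h i = c}))" by simp
    finally have "(real n)\<^sup>2 = (\<Sum>c\<in>h ` {..<n}. real (card {i \<in> {..<n}. h i = c}))\<^sup>2" by simp
    also have "\<dots> \<le> (\<Sum>c\<in>h ` {..<n}. (real (card {i \<in> {..<n}. h i = c}))\<^sup>2) * real (card (h ` {..<n}))"
      using sum_squared_le_sum_of_squares[of "\<lambda>c. real (card {i \<in> {..<n}. h i = c})" "h ` {..<n}"] by simp
    also have "\<dots> \<le> (\<Sum>c\<in>h ` {..<n}. (real (card {i \<in> {..<n}. h i = c}))\<^sup>2) * real M"
      using card_h by (intro mult_left_mono sum_nonneg) auto
    also have "(\<Sum>c\<in>h ` {..<n}. (real (card {i \<in> {..<n}. h i = c}))\<^sup>2) =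
        (\<Sum>i\<in>{..<n}. \<Sum>i'\<in>{..<n}. of_bool (\<forall>j\<in>u. g j i = g j i'))"
      unfolding h by (rule sum_pairs_same_value[symmetric]) simp
    finally show ?thesis using Mpos by (simp add: pos_divide_le_eq)
  qed
  have "S \<le> (\<Prod>j\<in>u. real (B j)) * (\<Sum>i\<in>{..<n}. \<Sum>i'\<in>{..<n}. of_bool (\<forall>j\<in>u. f j i = f j i')) -
             (\<Sum>i\<in>{..<n}. \<Sum>i'\<in>{..<n}. of_bool (\<forall>j\<in>u. g j i = g j i'))"
    unfolding S_def f_def g_def
    by (intro refinement_kernel_sum_bounds(2) u pos coarse_cell_div) auto
  also have "\<dots> \<le> (\<Prod>j\<in>u. real (B j)) * (real n * (real n / real L + 1)) - (real n)\<^sup>2 / real M"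
    by (intro diff_mono mult_left_mono fine coarse prod_nonneg) auto
  also have "\<dots> = real n * (\<Prod>j\<in>u. real (B j))"
  proof -
    have "(\<Prod>j\<in>u. real (B j)) > 0" by (intro prod_pos) (use pos in auto)
    then show ?thesis unfolding LM using Mpos by (simp add: field_simps power2_eq_square)
  qed
  finally have S: "S \<le> real n * (\<Prod>j\<in>u. real (B j))" .
  have inv_nonneg: "inverse (real (B j) - 1) \<ge> 0" if "j \<in> u" for j using B[OF that] by simp
  have "gain B x u k n = 1 / real n * (\<Prod>j\<in>u. inverse (real (B j) - 1)) * S"
    unfolding gain_def S_def f_def g_def ..
  also have "\<dots> \<le> 1 / real n * (\<Prod>j\<in>u. inverse (real (B j) - 1)) * (real n * (\<Prod>j\<in>u. real (B j)))"
    by (intro mult_left_mono S mult_nonneg_nonneg prod_nonneg) (use pos in \<open>auto simp: Suc_le_eq\<close>)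
  also have "\<dots> = (\<Prod>j\<in>u. real (B j)) * (\<Prod>j\<in>u. inverse (real (B j) - 1))" using n by simp
  also have "\<dots> = (\<Prod>j\<in>u. real (B j) / (real (B j) - 1))"
    by (simp add: divide_inverse flip: prod.distrib)
  finally show ?thesis .
qed

section \<open>Digit expansions\<close>

definition digit_series :: "nat \<Rightarrow> (nat \<Rightarrow> nat) \<Rightarrow> real" where
  "digit_series b D = (\<Sum>i. real (D i) / real b ^ Suc i)"

lemma geometric_digit_sums:
  assumes "b \<ge> (2::nat)"
  shows "(\<lambda>i. (real b - 1) / real b ^ Suc i) sums 1"
proof -
  have "(\<lambda>i. (1 / real b) ^ i) sums (1 / (1 - 1 / real b))"
    by (rule geometric_sums) (use assms in simp)
  then have "(\<lambda>i. (real b - 1) / real b * (1 / real b) ^ i) sums ((real b - 1) / real b * (1 / (1 - 1 / real b)))"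
    by (rule sums_mult)
  moreover have "(real b - 1) / real b * (1 / (1 - 1 / real b)) = 1"
    using assms by (simp add: field_simps)
  moreover have "(\<lambda>i. (real b - 1) / real b * (1 / real b) ^ i) = (\<lambda>i. (real b - 1) / real b ^ Suc i)"
    by (simp add: fun_eq_iff power_divide)
  ultimately show ?thesis by (simp only:)
qed

lemma summable_digit_series:
  assumes b: "b \<ge> (2::nat)" and D: "\<And>i. D i < b"
  shows "summable (\<lambda>i. real (D i) / real b ^ Suc i)"
proof (rule summable_comparison_test')
  show "summable (\<lambda>i. (real b - 1) / real b ^ Suc i)"
    using geometric_digit_sums[OF b] by (rule sums_summable)
  fix i
  have "real (D i) \<le> real b - 1" using D[of i] by linarith
  then show "norm (real (D i) / real b ^ Suc i) \<le> (real b - 1) / real b ^ Suc i"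
    using b by (auto intro: divide_right_mono)
qed

lemma digit_series_nonneg:
  assumes "b \<ge> (2::nat)" "\<And>i. D i < b"
  shows "digit_series b D \<ge> 0"
  unfolding digit_series_def by (rule suminf_nonneg[OF summable_digit_series[where D = D, OF assms]]) simp

lemma digit_series_less_1:
  assumes b: "b \<ge> (2::nat)" and D: "\<And>i. D i < b" and i0: "D i0 \<noteq> b - 1"
  shows "digit_series b D < 1"
proof -
  note geo = geometric_digit_sums[OF b]
  have le: "real (D i) \<le> real b - 1" for i using D[of i] by linarith
  have lt: "real (D i0) < real b - 1" using D[of i0] i0 by linarith
  have "(\<Sum>i. (real b - 1) / real b ^ Suc i - real (D i) / real b ^ Suc i) > 0"
  proof (rule suminf_pos2)
    show "summable (\<lambda>i. (real b - 1) / real b ^ Suc i - real (D i) / real b ^ Suc i)"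
      by (intro summable_diff summable_digit_series b D sums_summable[OF geo])
    show "0 \<le> (real b - 1) / real b ^ Suc i - real (D i) / real b ^ Suc i" for i
      using le[of i] b by (simp add: divide_right_mono)
    show "0 < (real b - 1) / real b ^ Suc i0 - real (D i0) / real b ^ Suc i0"
      using lt b by (simp add: divide_strict_right_mono)
  qed
  also have "(\<Sum>i. (real b - 1) / real b ^ Suc i - real (D i) / real b ^ Suc i) = 1 - digit_series b D"
    unfolding digit_series_def
    using suminf_diff[OF sums_summable[OF geo] summable_digit_series[where D = D, OF b D]] sums_unique[OF geo] by simp
  finally show ?thesis by simp
qed

lemma digit_series_shift:
  assumes b: "b \<ge> (2::nat)" and D: "\<And>i. D i < b"
  shows "real b * digit_series b D = real (D 0) + digit_series b (\<lambda>i. D (Suc i))"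
proof -
  note sm = summable_digit_series[where D = D, OF b D]
  have "digit_series b D = real (D 0) / real b + (\<Sum>i. real (D (Suc i)) / real b ^ Suc (Suc i))"
    unfolding digit_series_def using suminf_split_head[OF sm] by (simp del: power_Suc)
  also have "(\<Sum>i. real (D (Suc i)) / real b ^ Suc (Suc i)) = digit_series b (\<lambda>i. D (Suc i)) / real b"
    unfolding digit_series_def
    by (subst suminf_divide[symmetric, OF summable_digit_series[where D = "\<lambda>i. D (Suc i)", OF b D]])
       (simp add: mult_ac)
  finally show ?thesis using b by (simp add: field_simps)
qed

text \<open>
  Multiplication by \<open>b\<close> moves one digit in front of the point, and the remaining tail lies in
  \<open>[0, 1)\<close>. The tail cannot be 1 because some later digit differs from \<open>b - 1\<close>.
\<close>

lemma floor_digit_series: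
  assumes b: "b \<ge> (2::nat)" and D: "\<And>i. D i < b" and inf: "\<exists>\<^sub>\<infinity>i. D i \<noteq> b - 1"
  shows "real b ^ m * digit_series b D =
           real_of_int \<lfloor>real b ^ m * digit_series b D\<rfloor> + digit_series b (\<lambda>i. D (m + i))"
    and "\<lfloor>real b ^ Suc m * digit_series b D\<rfloor> = int b * \<lfloor>real b ^ m * digit_series b D\<rfloor> + int (D m)"
proof -
  have unit: "0 \<le> digit_series b (\<lambda>i. D (m + i))" "digit_series b (\<lambda>i. D (m + i)) < 1" for m
  proof -
    obtain i0 where "i0 \<ge> m" "D i0 \<noteq> b - 1" using inf by (auto simp: INFM_nat_le)
    then have "D (m + (i0 - m)) \<noteq> b - 1" by simp
    then show "digit_series b (\<lambda>i. D (m + i)) < 1"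
      by (intro digit_series_less_1[where D = "\<lambda>i. D (m + i)" and ?i0.0 = "i0 - m"]) (use b D in auto)
    show "0 \<le> digit_series b (\<lambda>i. D (m + i))"
      by (intro digit_series_nonneg b D)
  qed
  have step: "\<lfloor>real b ^ Suc m * digit_series b D\<rfloor> = int b * \<lfloor>real b ^ m * digit_series b D\<rfloor> + int (D m)
      \<and> real b ^ Suc m * digit_series b D =
           real_of_int \<lfloor>real b ^ Suc m * digit_series b D\<rfloor> + digit_series b (\<lambda>i. D (Suc m + i))"
    if "real b ^ m * digit_series b D =
           real_of_int \<lfloor>real b ^ m * digit_series b D\<rfloor> + digit_series b (\<lambda>i. D (m + i))" for m
  proof -
    let ?z = "\<lfloor>real b ^ m * digit_series b D\<rfloor>"
    have "real b ^ Suc m * digit_series b D = real b * (real b ^ m * digit_series b D)" by simp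
    also have "\<dots> = real b * real_of_int ?z + real b * digit_series b (\<lambda>i. D (m + i))"
      by (subst that) (simp add: algebra_simps)
    also have "real b * digit_series b (\<lambda>i. D (m + i)) = real (D m) + digit_series b (\<lambda>i. D (Suc m + i))"
      using digit_series_shift[of b "\<lambda>i. D (m + i)"] b D by simp
    finally have eq: "real b ^ Suc m * digit_series b D =
        real_of_int (int b * ?z + int (D m)) + digit_series b (\<lambda>i. D (Suc m + i))" by simp
    have "\<lfloor>real b ^ Suc m * digit_series b D\<rfloor> = int b * ?z + int (D m)"
      unfolding eq using unit[of "Suc m"] by (intro floor_unique) linarith+
    note floor_eq = this
    show ?thesis unfolding floor_eq by (intro conjI refl eq)
  qed
  show base: "real b ^ m * digit_series b D =
           real_of_int \<lfloor>real b ^ m * digit_series b D\<rfloor> + digit_series b (\<lambda>i. D (m + i))" for m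
  proof (induction m)
    case 0
    have "\<lfloor>digit_series b D\<rfloor> = 0" using unit[of 0] by (simp add: floor_eq_iff)
    then show ?case by simp
  next
    case (Suc m)
    then show ?case using step[of m] by blast
  qed
  show "\<lfloor>real b ^ Suc m * digit_series b D\<rfloor> = int b * \<lfloor>real b ^ m * digit_series b D\<rfloor> + int (D m)"
    using step[OF base[of m]] by blast
qed

lemma digits_eq_if_floor_eq:
  assumes b: "b \<ge> (2::nat)"
    and D: "\<And>i. D i < b" "\<exists>\<^sub>\<infinity>i. D i \<noteq> b - 1" and D': "\<And>i. D' i < b" "\<exists>\<^sub>\<infinity>i. D' i \<noteq> b - 1"
    and eq: "\<lfloor>real b ^ m * digit_series b D\<rfloor> = \<lfloor>real b ^ m * digit_series b D'\<rfloor>" and "i < m"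
  shows "D i = D' i"
  using eq \<open>i < m\<close>
proof (induction m)
  case (Suc m)
  let ?z = "\<lfloor>real b ^ m * digit_series b D\<rfloor>" and ?z' = "\<lfloor>real b ^ m * digit_series b D'\<rfloor>"
  have eq: "int b * ?z + int (D m) = int b * ?z' + int (D' m)"
    using Suc.prems(1) unfolding floor_digit_series(2)[OF b D] floor_digit_series(2)[OF b D'] .
  have "(int b * ?z + int (D m)) div int b = ?z" "(int b * ?z + int (D m)) mod int b = int (D m)"
    "(int b * ?z' + int (D' m)) div int b = ?z'" "(int b * ?z' + int (D' m)) mod int b = int (D' m)"
    using D(1)[of m] D'(1)[of m] b by auto
  then have "?z = ?z'" "D m = D' m" using eq by auto
  then show ?case using Suc.IH Suc.prems(2) by (cases "i = m") auto
qed simp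

lemma card_field_ge_2: "CARD('a :: {field, finite}) \<ge> 2"
proof -
  have "card {0, 1 :: 'a} \<le> CARD('a)" by (intro card_mono) auto
  then show ?thesis by simp
qed

context
  fixes \<phi> :: "nat \<Rightarrow> 'a :: {field, finite}"
  assumes \<phi>: "digit_bijection \<phi>"
begin

lemma digit_of_less: "digit_of \<phi> c < CARD('a)"
  using the_inv_into_into[of \<phi> "{..<CARD('a)}" c "{..<CARD('a)}"] \<phi>
  unfolding digit_of_def digit_bijection_def bij_betw_def by auto

lemma digit_of_inverse: "\<phi> (digit_of \<phi> c) = c"
  using f_the_inv_into_f[of \<phi> "{..<CARD('a)}" c] \<phi>
  unfolding digit_of_def digit_bijection_def bij_betw_def by auto

lemma digital_point_eq_digit_series:
  "digital_point \<phi> C i j = digit_series CARD('a) (\<lambda>k. digit_of \<phi> (mat_digit_vec \<phi> (C j) i (Suc k)))"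
  by (simp add: digital_point_def digit_value_def digit_series_def)

lemma regular_digit_sequence:
  assumes "regular_digits \<phi> C d" "j \<in> {1..d}"
  shows "\<exists>\<^sub>\<infinity>k. digit_of \<phi> (mat_digit_vec \<phi> (C j) i (Suc k)) \<noteq> CARD('a) - 1"
  unfolding INFM_nat_le
proof
  fix m
  obtain k where "k \<ge> Suc m" "mat_digit_vec \<phi> (C j) i k \<noteq> \<phi> (CARD('a) - 1)"
    using assms unfolding regular_digits_def INFM_nat_le by blast
  \<comment> \<open>the rows of a generating matrix are numbered from 1, the terms of a digit series from 0\<close>
  then obtain k' where k': "k' \<ge> m" "mat_digit_vec \<phi> (C j) i (Suc k') \<noteq> \<phi> (CARD('a) - 1)"
    by (cases k) auto
  have "digit_of \<phi> (mat_digit_vec \<phi> (C j) i (Suc k')) \<noteq> CARD('a) - 1"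
    using k'(2) digit_of_inverse[of "mat_digit_vec \<phi> (C j) i (Suc k')"] by metis
  then show "\<exists>k\<ge>m. digit_of \<phi> (mat_digit_vec \<phi> (C j) i (Suc k)) \<noteq> CARD('a) - 1"
    using k'(1) by blast
qed

lemma digital_point_unit:
  assumes "regular_digits \<phi> C d" "j \<in> {1..d}"
  shows "0 \<le> digital_point \<phi> C i j \<and> digital_point \<phi> C i j < 1"
proof -
  obtain k where "digit_of \<phi> (mat_digit_vec \<phi> (C j) i (Suc k)) \<noteq> CARD('a) - 1"
    using regular_digit_sequence[OF assms, of i] by (auto dest: INFM_EX)
  then show ?thesis unfolding digital_point_eq_digit_series
    by (intro conjI digit_series_nonneg digit_series_less_1 card_field_ge_2 digit_of_less)
qed

lemma mat_digit_vec_eq_if_floor_eq: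
  assumes reg: "regular_digits \<phi> C d" "j \<in> {1..d}"
    and eq: "\<lfloor>real CARD('a) ^ m * digital_point \<phi> C i j\<rfloor> = \<lfloor>real CARD('a) ^ m * digital_point \<phi> C i' j\<rfloor>"
    and k: "1 \<le> k" "k \<le> m"
  shows "mat_digit_vec \<phi> (C j) i k = mat_digit_vec \<phi> (C j) i' k"
proof -
  have "digit_of \<phi> (mat_digit_vec \<phi> (C j) i (Suc (k - 1))) =
        digit_of \<phi> (mat_digit_vec \<phi> (C j) i' (Suc (k - 1)))"
    by (rule digits_eq_if_floor_eq[where D = "\<lambda>k. digit_of \<phi> (mat_digit_vec \<phi> (C j) i (Suc k))"
          and D' = "\<lambda>k. digit_of \<phi> (mat_digit_vec \<phi> (C j) i' (Suc k))" and m = m])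
       (use k card_field_ge_2 digit_of_less regular_digit_sequence[OF reg]
          eq[unfolded digital_point_eq_digit_series] in simp_all)
  then show ?thesis using k digit_of_inverse by (metis Suc_diff_1 less_eq_Suc_le One_nat_def)
qed

text \<open>
  The digit vector of \<open>i\<close> vanishes beyond position \<open>i\<close>, so sums for two indices can be
  taken over a common range.
\<close>

lemma mat_digit_vec_eq_sum:
  assumes "i \<le> W"
  shows "mat_digit_vec \<phi> M i k = (\<Sum>r = 1..W. M k r * digit_vec \<phi> i r)"
proof -
  have "digit_vec \<phi> i r = 0" if "r > i" for r
  proof -
    have "i < CARD('a) ^ i" using card_field_ge_2[where 'a = 'a] by (intro power_gt_expt) simp
    also have "\<dots> \<le> CARD('a) ^ (r - 1)" using that by (intro power_increasing) auto
    finally show ?thesis using \<phi> by (simp add: digit_vec_def digit_bijection_def)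
  qed
  then show ?thesis unfolding mat_digit_vec_def
    by (intro sum.mono_neutral_left) (use assms in auto)
qed

lemma digits_determine_index:
  assumes high: "i div CARD('a) ^ m = i' div CARD('a) ^ m"
    and low: "\<And>r. 1 \<le> r \<Longrightarrow> r \<le> m \<Longrightarrow> digit_vec \<phi> i r = digit_vec \<phi> i' r"
  shows "i = i'"
  using assms
proof (induction m)
  case (Suc m)
  have "\<phi> (i div CARD('a) ^ m mod CARD('a)) = \<phi> (i' div CARD('a) ^ m mod CARD('a))"
    using Suc.prems(2)[of "Suc m"] by (simp add: digit_vec_def)
  moreover have "inj_on \<phi> {..<CARD('a)}" using \<phi> by (simp add: digit_bijection_def bij_betw_def)
  ultimately have "i div CARD('a) ^ m mod CARD('a) = i' div CARD('a) ^ m mod CARD('a)"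
    by (auto dest!: inj_onD)
  moreover have "i div CARD('a) ^ m div CARD('a) = i' div CARD('a) ^ m div CARD('a)"
    using Suc.prems(1) unfolding power_Suc2 div_mult2_eq .
  ultimately have "i div CARD('a) ^ m = i' div CARD('a) ^ m"
    by (metis div_mult_mod_eq)
  then show ?case using Suc by simp
qed simp

lemma digit_vec_eq_if_div_eq:
  assumes "i div CARD('a) ^ m = i' div CARD('a) ^ m" "r > m"
  shows "digit_vec \<phi> i r = digit_vec \<phi> i' r"
proof -
  have "CARD('a) ^ (r - 1) = CARD('a) ^ m * CARD('a) ^ (r - 1 - m)"
    using assms(2) by (simp flip: power_add)
  then show ?thesis using assms(1) by (simp add: digit_vec_def div_mult2_eq)
qed

end

section \<open>Linear independence in the generating matrices\<close>

lemma laurent_at_infinity_0 [simp]: "laurent_at_infinity 0 = 0"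
  by (simp add: laurent_at_infinity_def)

lemma laurent_at_infinity_pCons:
  "laurent_at_infinity (pCons a f) = fls_const a + fls_X_inv * laurent_at_infinity f"
  by (simp add: laurent_at_infinity_def map_poly_pCons)

lemma laurent_at_infinity_nth:
  "fls_nth (laurent_at_infinity f) n = (if n \<le> 0 then coeff f (nat (- n)) else 0)"
proof (induction f arbitrary: n rule: pCons_induct)
  case (pCons a f)
  have "nat (- n) = Suc (nat (- n - 1))" if "n < 0" using that by simp
  then show ?case
    by (cases "n = 0"; cases "n < 0")
       (auto simp: laurent_at_infinity_pCons fls_X_inv_times_conv_shift pCons.IH)
qed simp

lemma laurent_at_infinity_add:
  "laurent_at_infinity (f + g) = laurent_at_infinity f + laurent_at_infinity g"
  by (rule fls_eqI) (simp add: laurent_at_infinity_nth)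

lemma laurent_at_infinity_sum:
  "laurent_at_infinity (\<Sum>i\<in>A. f i) = (\<Sum>i\<in>A. laurent_at_infinity (f i))"
  by (induction A rule: infinite_finite_induct) (auto simp: laurent_at_infinity_add)

lemma laurent_at_infinity_smult:
  "laurent_at_infinity (smult c f) = fls_const c * laurent_at_infinity f"
  by (rule fls_eqI) (simp add: laurent_at_infinity_nth)

lemma laurent_at_infinity_mult:
  "laurent_at_infinity (f * g) = laurent_at_infinity f * laurent_at_infinity g"
proof (induction f rule: pCons_induct)
  case (pCons a f)
  have "laurent_at_infinity (pCons a f * g) = laurent_at_infinity (smult a g + pCons 0 (f * g))" by simp
  also have "\<dots> = fls_const a * laurent_at_infinity g + fls_X_inv * (laurent_at_infinity f * laurent_at_infinity g)"
    by (simp only: laurent_at_infinity_add laurent_at_infinity_smult laurent_at_infinity_pCons pCons.IH) simp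
  also have "\<dots> = laurent_at_infinity (pCons a f) * laurent_at_infinity g"
    by (simp add: laurent_at_infinity_pCons algebra_simps)
  finally show ?case .
qed simp

lemma laurent_at_infinity_1 [simp]: "laurent_at_infinity 1 = 1"
  by (rule fls_eqI) (auto simp: laurent_at_infinity_nth)

lemma laurent_at_infinity_power: "laurent_at_infinity (f ^ n) = laurent_at_infinity f ^ n"
  by (induction n) (auto simp: laurent_at_infinity_mult)

lemma laurent_at_infinity_eq_0_iff: "laurent_at_infinity f = 0 \<longleftrightarrow> f = 0"
proof
  assume *: "laurent_at_infinity f = 0"
  have "coeff f n = fls_nth (laurent_at_infinity f) (- int n)" for n
    by (simp add: laurent_at_infinity_nth)
  then show "f = 0" using * by (simp add: poly_eq_iff)
qed simp

lemma subdegree_laurent_at_infinity: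
  assumes "f \<noteq> 0"
  shows "fls_subdegree (laurent_at_infinity f) = - int (degree f)"
proof (rule fls_subdegree_eqI)
  show "fls_nth (laurent_at_infinity f) (- int (degree f)) \<noteq> 0"
    using assms by (simp add: laurent_at_infinity_nth)
  show "fls_nth (laurent_at_infinity f) k = 0" if "k < - int (degree f)" for k
    using that by (auto simp: laurent_at_infinity_nth intro!: coeff_eq_0)
qed

text \<open>
  This is where vanishing coefficients become divisibility. Subtracting the polynomial part of
  \<open>P / Q\<close> leaves a proper fraction \<open>t / Q\<close>. If \<open>t\<close> is nonzero, then the expansion of \<open>t / Q\<close>
  starts at the index \<open>degree Q - degree t\<close>, which is one of the indices where the coefficient is
  assumed to vanish.
\<close>

lemma denominator_dvd_numerator:
  fixes P Q :: "'a :: field poly"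
  assumes "Q \<noteq> 0" and R: "R * laurent_at_infinity Q = laurent_at_infinity P"
    and van: "\<And>r. 1 \<le> r \<Longrightarrow> r \<le> degree Q \<Longrightarrow> fls_nth R (int r) = 0"
  shows "Q dvd P"
proof (rule ccontr)
  assume ndvd: "\<not> Q dvd P"
  define s t where "s = P div Q" and "t = P mod Q"
  define R' where "R' = R - laurent_at_infinity s"
  have t: "t \<noteq> 0" using ndvd by (simp add: t_def mod_eq_0_iff_dvd)
  have deg: "degree t < degree Q"
    unfolding t_def by (rule degree_mod_less_degree) (use ndvd assms in auto)
  have "P = s * Q + t" by (simp add: s_def t_def)
  then have eq: "R' * laurent_at_infinity Q = laurent_at_infinity t"
    using R by (simp add: R'_def laurent_at_infinity_add laurent_at_infinity_mult algebra_simps)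
  then have "R' \<noteq> 0" using t by (auto simp: laurent_at_infinity_eq_0_iff)
  then have "fls_subdegree R' + fls_subdegree (laurent_at_infinity Q) = fls_subdegree (laurent_at_infinity t)"
    using eq \<open>Q \<noteq> 0\<close> by (metis fls_subdegree_mult laurent_at_infinity_eq_0_iff)
  then have sub: "fls_subdegree R' = int (degree Q - degree t)"
    using deg t \<open>Q \<noteq> 0\<close> by (simp add: subdegree_laurent_at_infinity)
  have "fls_nth R' (int (degree Q - degree t)) = 0"
    unfolding R'_def using deg van[of "degree Q - degree t"] by (simp add: laurent_at_infinity_nth)
  then have "fls_nth R' (fls_subdegree R') = 0" unfolding sub .
  then show False using \<open>R' \<noteq> 0\<close> by (simp add: nth_fls_subdegree_zero_iff)
qed

lemma poly_mod_sum: "(\<Sum>i\<in>A. f i :: 'a :: field poly) mod p = (\<Sum>i\<in>A. f i mod p)"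
  by (induction A rule: infinite_finite_induct) (auto simp: poly_mod_add_left)

text \<open>
  A partial fraction with denominator a power of \<open>p\<close> can only be a polynomial if all its
  coefficients vanish. The rows of the highest level are the only ones that are not multiplied
  by \<open>p\<close> after clearing denominators, so modulo \<open>p\<close> the independence of their residues applies.
  Dividing by \<open>p\<close> then lowers the level.
\<close>

lemma level_coefficients_vanish:
  fixes p :: "'a :: field poly"
  assumes e: "degree p > 0"
    and indep: "\<And>q. q \<ge> 1 \<Longrightarrow> independent_residues p y
        {k. 1 \<le> k \<and> (q - 1) * degree p \<le> k - 1 \<and> k - 1 < q * degree p}"
    and dvd: "p ^ K dvd (\<Sum>k=1..degree p * K. smult (c k) (y k * p ^ (K - 1 - (k - 1) div degree p)))"
    and k: "k \<in> {1..degree p * K}"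
  shows "c k = 0"
  using dvd k
proof (induction K arbitrary: k)
  case (Suc K)
  let ?e = "degree p"
  define S where "S = (\<Sum>k=1..?e * K. smult (c k) (y k * p ^ (K - 1 - (k - 1) div ?e)))"
  define T where "T = (\<Sum>k=?e * K + 1..?e * K + ?e. smult (c k) (y k))"
  have "p \<noteq> 0" using e by auto
  have level: "(k - 1) div ?e < K" if "k \<in> {1..?e * K}" for k
  proof -
    have "k - 1 < K * ?e" using that by (simp add: mult.commute) linarith
    then show ?thesis by (rule less_mult_imp_div_less)
  qed
  have "(\<Sum>k=1..?e * Suc K. smult (c k) (y k * p ^ (Suc K - 1 - (k - 1) div ?e))) =
        (\<Sum>k=1..?e * K. smult (c k) (y k * p ^ (Suc K - 1 - (k - 1) div ?e))) +
        (\<Sum>k=?e * K + 1..?e * K + ?e. smult (c k) (y k * p ^ (Suc K - 1 - (k - 1) div ?e)))"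
    by (subst sum.ub_add_nat[symmetric]) (auto simp: add.commute)
  also have "(\<Sum>k=1..?e * K. smult (c k) (y k * p ^ (Suc K - 1 - (k - 1) div ?e))) = p * S"
    unfolding S_def sum_distrib_left
  proof (rule sum.cong[OF refl])
    fix k assume "k \<in> {1..?e * K}"
    then have "Suc K - 1 - (k - 1) div ?e = Suc (K - 1 - (k - 1) div ?e)" using level[of k] by simp
    then show "smult (c k) (y k * p ^ (Suc K - 1 - (k - 1) div ?e)) =
               p * smult (c k) (y k * p ^ (K - 1 - (k - 1) div ?e))" by (simp add: mult_ac)
  qed
  also have "(\<Sum>k=?e * K + 1..?e * K + ?e. smult (c k) (y k * p ^ (Suc K - 1 - (k - 1) div ?e))) = T"
    unfolding T_def
  proof (rule sum.cong[OF refl])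
    fix k assume "k \<in> {?e * K + 1..?e * K + ?e}"
    then have "(k - 1) div ?e = K"
      by (intro div_nat_eqI) (auto simp: mult.commute)
    then show "smult (c k) (y k * p ^ (Suc K - 1 - (k - 1) div ?e)) = smult (c k) (y k)" by simp
  qed
  finally have dvd: "p ^ Suc K dvd p * S + T" using Suc.prems(1) by simp
  then have "p dvd p * S + T" by (rule dvd_trans[rotated]) simp
  then have "p dvd T" by (simp add: dvd_add_right_iff)
  then have "T mod p = 0" by (simp add: mod_eq_0_iff_dvd)
  then have zero: "(\<Sum>k=?e * K + 1..?e * K + ?e. smult (c k) (y k mod p)) = 0"
    by (simp add: T_def poly_mod_sum mod_smult_left)
  have level_set: "{k. 1 \<le> k \<and> (Suc K - 1) * ?e \<le> k - 1 \<and> k - 1 < Suc K * ?e} = {?e * K + 1..?e * K + ?e}"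
    by (auto simp: mult.commute)
  have "independent_residues p y {?e * K + 1..?e * K + ?e}"
    using indep[of "Suc K"] unfolding level_set by simp
  then have top: "c k = 0" if "k \<in> {?e * K + 1..?e * K + ?e}" for k
    using zero that unfolding independent_residues_def by blast
  then have "T = 0" by (simp add: T_def)
  then have "p ^ K dvd S" using dvd \<open>p \<noteq> 0\<close> by simp
  then have "c k = 0" if "k \<in> {1..?e * K}" for k
    using Suc.IH that unfolding S_def by blast
  then show ?case using Suc.prems(2) top[of k] by (cases "k \<le> ?e * K") auto
qed simp

text \<open>
  A set \<open>u\<close> of coordinates of a generalized Niederreiter sequence with irreducible base
  polynomials. Coprimality is recorded as non-divisibility, the form in which it is used for
  prime elements.
\<close>

locale irreducible_bases =
  fixes p :: "nat \<Rightarrow> 'a :: {field, finite} poly" and y :: "nat \<Rightarrow> nat \<Rightarrow> 'a poly" and u :: "nat set"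
  assumes fin: "finite u"
    and irred: "\<And>j. j \<in> u \<Longrightarrow> irreducible (p j)"
    and deg: "\<And>j. j \<in> u \<Longrightarrow> degree (p j) > 0"
    and distinct: "\<And>i j. i \<in> u \<Longrightarrow> j \<in> u \<Longrightarrow> i \<noteq> j \<Longrightarrow> \<not> p i dvd p j"
    and indep: "\<And>j q. j \<in> u \<Longrightarrow> q \<ge> 1 \<Longrightarrow> independent_residues (p j) (y j)
        {k. 1 \<le> k \<and> (q - 1) * degree (p j) \<le> k - 1 \<and> k - 1 < q * degree (p j)}"
begin

lemma prime: "j \<in> u \<Longrightarrow> prime_elem (p j)"
  using irred by (rule field_poly_irreducible_imp_prime)

lemma nonzero: "j \<in> u \<Longrightarrow> p j \<noteq> 0"
  using deg by fastforce

lemma not_dvd_other_powers: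
  assumes "j \<in> u"
  shows "\<not> p j dvd (\<Prod>i\<in>u - {j}. p i ^ K i)"
proof -
  have "\<not> p j dvd (\<Prod>i\<in>A. p i ^ K i)" if "finite A" "A \<subseteq> u - {j}" for A
    using that
  proof (induction A rule: finite_induct)
    case empty
    then show ?case using prime[OF assms] by (simp add: prime_elem_not_unit)
  next
    case (insert i A)
    then have "\<not> p j dvd p i ^ K i"
      using distinct[OF assms, of i] prime_elem_dvd_power[OF prime[OF assms]] by blast
    then show ?case using insert by (simp add: prime_elem_dvd_mult_iff[OF prime[OF assms]])
  qed
  then show ?thesis using fin by simp
qed

text \<open>
  Tezuka's argument. A vanishing combination of rows, restricted to the first \<open>m\<close> columns, says
  that \<open>m\<close> coefficients of a rational function vanish whose denominator \<open>Q\<close> has degree \<open>m\<close>. So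
  the function is a polynomial. As the powers of different \<open>p j\<close> are coprime, the partial
  fraction belonging to each single \<open>p j\<close> is a polynomial.
\<close>

lemma rows_independent:
  fixes K :: "nat \<Rightarrow> nat" and c :: "nat \<Rightarrow> nat \<Rightarrow> 'a"
  assumes van: "\<And>r. r \<in> {1..\<Sum>j\<in>u. degree (p j) * K j} \<Longrightarrow>
      (\<Sum>j\<in>u. \<Sum>k = 1..degree (p j) * K j. c j k * niederreiter_matrix p y j k r) = 0"
    and j: "j \<in> u" and k: "k \<in> {1..degree (p j) * K j}"
  shows "c j k = 0"
proof -
  let ?L = laurent_at_infinity
  define lev where "lev = (\<lambda>j k. (k - 1) div degree (p j))"
  define Q where "Q = (\<Prod>i\<in>u. p i ^ K i)"
  define Q' where "Q' = (\<lambda>j. \<Prod>i\<in>u - {j}. p i ^ K i)"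
  define S where "S = (\<lambda>j. \<Sum>k = 1..degree (p j) * K j. smult (c j k) (y j k * p j ^ (K j - 1 - lev j k)))"
  define R where "R = (\<Sum>j\<in>u. \<Sum>k = 1..degree (p j) * K j.
      fls_const (c j k) * (?L (y j k) / ?L (p j) ^ (lev j k + 1)))"
  have Q: "Q = p j ^ K j * Q' j" if "j \<in> u" for j
    unfolding Q_def Q'_def using fin that by (rule prod.remove)
  have "Q \<noteq> 0" unfolding Q_def using nonzero fin by simp
  have deg_Q: "degree Q = (\<Sum>j\<in>u. degree (p j) * K j)"
    unfolding Q_def
    by (subst degree_prod_eq_sum_degree) (auto simp: nonzero degree_power_eq mult.commute)
  have lev: "lev j k < K j" if "j \<in> u" "k \<in> {1..degree (p j) * K j}" for j k
  proof -
    have "k - 1 < K j * degree (p j)" using that(2) by (simp add: mult.commute) linarith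
    then show ?thesis unfolding lev_def by (rule less_mult_imp_div_less)
  qed
  have clear: "fls_const (c j k) * (?L (y j k) / ?L (p j) ^ (lev j k + 1)) * ?L Q =
               ?L (smult (c j k) (y j k * p j ^ (K j - 1 - lev j k)) * Q' j)"
    if "j \<in> u" "k \<in> {1..degree (p j) * K j}" for j k
  proof -
    have "K j = (lev j k + 1) + (K j - 1 - lev j k)" using lev[OF that] by simp
    then have "p j ^ K j = p j ^ (lev j k + 1) * p j ^ (K j - 1 - lev j k)" by (metis power_add)
    then have "?L Q = ?L (p j) ^ (lev j k + 1) * ?L (p j ^ (K j - 1 - lev j k) * Q' j)"
      using Q[OF that(1)] by (simp only: laurent_at_infinity_mult laurent_at_infinity_power mult.assoc)
    moreover have "?L (p j) \<noteq> 0" using nonzero that by (simp add: laurent_at_infinity_eq_0_iff)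
    ultimately show ?thesis
      by (simp add: laurent_at_infinity_mult laurent_at_infinity_smult laurent_at_infinity_power)
  qed
  have "R * ?L Q = ?L (\<Sum>j\<in>u. S j * Q' j)"
    unfolding R_def S_def laurent_at_infinity_sum sum_distrib_right
    by (intro sum.cong refl clear)
  moreover have "fls_nth R (int r) = 0" if "1 \<le> r" "r \<le> degree Q" for r
  proof -
    have "fls_nth R (int r) =
          (\<Sum>j\<in>u. \<Sum>k = 1..degree (p j) * K j. c j k * niederreiter_matrix p y j k r)"
      by (simp only: R_def fls_nth_sum fls_mult_const_nth niederreiter_matrix_def lev_def)
    then show ?thesis using van[of r] that by (simp add: deg_Q)
  qed
  ultimately have "Q dvd (\<Sum>j\<in>u. S j * Q' j)"
    by (intro denominator_dvd_numerator \<open>Q \<noteq> 0\<close>)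
  then have "p j ^ K j dvd (\<Sum>j\<in>u. S j * Q' j)" using Q[OF j] by (metis dvd_mult_left)
  moreover have "(\<Sum>j\<in>u. S j * Q' j) = S j * Q' j + (\<Sum>i\<in>u - {j}. S i * Q' i)"
    using fin j by (rule sum.remove)
  moreover have "p j ^ K j dvd (\<Sum>i\<in>u - {j}. S i * Q' i)"
    unfolding Q'_def by (intro dvd_sum dvd_mult dvd_prodI) (use fin j in auto)
  ultimately have "p j ^ K j dvd Q' j * S j" by (simp add: dvd_add_left_iff mult.commute)
  moreover have "\<not> p j dvd Q' j" unfolding Q'_def by (rule not_dvd_other_powers[OF j])
  moreover have "K j > 0" using k by (cases "K j = 0") auto
  ultimately have "p j ^ K j dvd S j"
    using prime_power_dvd_multD[OF prime[OF j]] by blast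
  then show ?thesis
    unfolding S_def lev_def by (intro level_coefficients_vanish[OF deg[OF j] indep[OF j] _ k])
qed

text \<open>
  A square matrix with independent rows has independent columns. Over a finite field this
  follows by counting: the map from row coefficients to row combinations is injective between sets
  of equal size, hence each unit vector is a combination of rows.
\<close>

lemma columns_independent:
  fixes K :: "nat \<Rightarrow> nat" and v :: "nat \<Rightarrow> 'a"
  defines "m \<equiv> \<Sum>j\<in>u. degree (p j) * K j"
  assumes zero: "\<And>j k. j \<in> u \<Longrightarrow> k \<in> {1..degree (p j) * K j} \<Longrightarrow>
      (\<Sum>r = 1..m. niederreiter_matrix p y j k r * v r) = 0"
    and r: "r \<in> {1..m}"
  shows "v r = 0"
proof -
  define Rw where "Rw = (SIGMA j:u. {1..degree (p j) * K j})"
  define comb where "comb = (\<lambda>c :: nat \<times> nat \<Rightarrow> 'a.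
      \<lambda>r\<in>{1..m}. \<Sum>(j, k)\<in>Rw. c (j, k) * niederreiter_matrix p y j k r)"
  have finR: "finite Rw" unfolding Rw_def using fin by simp
  have "card Rw = m" unfolding Rw_def m_def using fin by simp
  have "inj_on comb (PiE Rw (\<lambda>_. UNIV))"
  proof (rule inj_onI)
    fix c c' assume c: "c \<in> PiE Rw (\<lambda>_. UNIV)" "c' \<in> PiE Rw (\<lambda>_. UNIV)" and eq: "comb c = comb c'"
    have "c (j, k) - c' (j, k) = 0" if "j \<in> u" "k \<in> {1..degree (p j) * K j}" for j k
    proof (rule rows_independent[of K "\<lambda>j k. c (j, k) - c' (j, k)", OF _ that])
      fix r assume "r \<in> {1..\<Sum>j\<in>u. degree (p j) * K j}"
      then have "comb c r - comb c' r = (\<Sum>(j, k)\<in>Rw. (c (j, k) - c' (j, k)) * niederreiter_matrix p y j k r)"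
        unfolding comb_def m_def
        by (simp add: sum_subtractf[symmetric] left_diff_distrib case_prod_beta)
      also have "\<dots> = (\<Sum>j\<in>u. \<Sum>k = 1..degree (p j) * K j.
          (c (j, k) - c' (j, k)) * niederreiter_matrix p y j k r)"
        unfolding Rw_def by (rule sum.Sigma[symmetric]) (use fin in auto)
      finally show "(\<Sum>j\<in>u. \<Sum>k = 1..degree (p j) * K j.
          (c (j, k) - c' (j, k)) * niederreiter_matrix p y j k r) = 0"
        using eq by simp
    qed
    then have "c jk = c' jk" if "jk \<in> Rw" for jk using that unfolding Rw_def by auto
    then show "c = c'" using c by (intro PiE_ext) auto
  qed
  moreover have "comb ` PiE Rw (\<lambda>_. UNIV) \<subseteq> PiE {1..m} (\<lambda>_. UNIV)"
    by (auto simp: comb_def)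
  moreover have "card (PiE Rw (\<lambda>_. UNIV :: 'a set)) = card (PiE {1..m} (\<lambda>_. UNIV :: 'a set))"
    using finR \<open>card Rw = m\<close> by (simp add: card_PiE)
  ultimately have "comb ` PiE Rw (\<lambda>_. UNIV) = PiE {1..m} (\<lambda>_. UNIV)"
    by (intro card_subset_eq finite_PiE) (auto simp: card_image)
  \<comment> \<open>coefficients of the rows that combine to the unit vector of the column \<open>r\<close>\<close>
  moreover have "(\<lambda>s\<in>{1..m}. of_bool (s = r)) \<in> PiE {1..m} (\<lambda>_. UNIV :: 'a set)" by auto
  ultimately obtain c where c: "comb c = (\<lambda>s\<in>{1..m}. of_bool (s = r))" by (metis imageE)
  have "v r = (\<Sum>s = 1..m. of_bool (s = r) * v s)"
  proof -
    have "(\<Sum>s = 1..m. of_bool (s = r) * v s) = (\<Sum>s = 1..m. if s = r then v s else 0)"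
      by (intro sum.cong) auto
    then show ?thesis using r by simp
  qed
  also have "\<dots> = (\<Sum>s = 1..m. (\<Sum>(j, k)\<in>Rw. c (j, k) * niederreiter_matrix p y j k s) * v s)"
  proof (intro sum.cong refl arg_cong2[of _ _ _ _ "(*)"])
    fix s assume "s \<in> {1..m}"
    then show "of_bool (s = r) = (\<Sum>(j, k)\<in>Rw. c (j, k) * niederreiter_matrix p y j k s)"
      using fun_cong[OF c, of s] by (simp add: comb_def)
  qed
  also have "\<dots> = (\<Sum>s = 1..m. \<Sum>jk\<in>Rw. c jk * (niederreiter_matrix p y (fst jk) (snd jk) s * v s))"
    by (simp add: sum_distrib_right case_prod_beta mult.assoc)
  also have "\<dots> = (\<Sum>jk\<in>Rw. \<Sum>s = 1..m. c jk * (niederreiter_matrix p y (fst jk) (snd jk) s * v s))"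
    by (rule sum.swap)
  also have "\<dots> = (\<Sum>jk\<in>Rw. c jk * 0)"
  proof (intro sum.cong refl)
    fix jk assume "jk \<in> Rw"
    then have "(\<Sum>s = 1..m. niederreiter_matrix p y (fst jk) (snd jk) s * v s) = 0"
      by (intro zero) (auto simp: Rw_def)
    then show "(\<Sum>s = 1..m. c jk * (niederreiter_matrix p y (fst jk) (snd jk) s * v s)) = c jk * 0"
      by (simp add: sum_distrib_left[symmetric])
  qed
  finally show ?thesis by simp
qed

end

section \<open>Gain coefficients of generalized Niederreiter sequences\<close>

text \<open>
  Two indices in an aligned block of length \<open>b ^ m\<close> have digit vectors that differ only in the
  first \<open>m\<close> places. If their points share a fine box, then the rows belonging to that box annihilate
  the difference, so the difference is zero and the indices coincide.
\<close>

lemma generalized_niederreiter_gain_bounds: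
  fixes \<phi> :: "nat \<Rightarrow> 'a :: {field, finite}"
  assumes gn: "generalized_niederreiter \<phi> p y d"
    and irred: "\<And>j. j \<in> {1..d} \<Longrightarrow> irreducible (p j)"
    and u: "u \<noteq> {}" "u \<subseteq> {1..d}" and n: "n > 0"
  shows "gain (\<lambda>j. CARD('a) ^ degree (p j)) (niederreiter_point \<phi> p y) u k n \<ge> 0"
    and "gain (\<lambda>j. CARD('a) ^ degree (p j)) (niederreiter_point \<phi> p y) u k n \<le>
           (\<Prod>j\<in>u. real (CARD('a) ^ degree (p j)) / (real (CARD('a) ^ degree (p j)) - 1))"
proof -
  let ?b = "CARD('a)" and ?C = "niederreiter_matrix p y"
  have fin: "finite u" using u(2) finite_subset by blast
  have \<phi>: "digit_bijection \<phi>" and reg: "regular_digits \<phi> ?C d"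
    using gn by (auto simp: generalized_niederreiter_def)
  have deg: "degree (p j) > 0" if "j \<in> u" for j
  proof -
    have "j \<in> {1..d}" using that u by blast
    then show ?thesis using gn unfolding generalized_niederreiter_def by blast
  qed
  interpret irreducible_bases p y u
  proof
    show "irreducible (p j)" if "j \<in> u" for j using irred u that by blast
    show "\<not> p i dvd p j" if "i \<in> u" "j \<in> u" "i \<noteq> j" for i j
    proof
      assume "p i dvd p j"
      moreover have "i \<in> {1..d}" "j \<in> {1..d}" using that u by auto
      then have "coprime (p i) (p j)"
        using gn that(3) unfolding generalized_niederreiter_def by blast
      ultimately have "is_unit (p i)" by (metis coprime_common_divisor dvd_refl)
      then show False using deg[OF that(1)] by (auto simp: is_unit_poly_iff)
    qed
    show "independent_residues (p j) (y j)
        {k. 1 \<le> k \<and> (q - 1) * degree (p j) \<le> k - 1 \<and> k - 1 < q * degree (p j)}"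
      if "j \<in> u" "q \<ge> 1" for j q
    proof -
      have "j \<in> {1..d}" using that u by blast
      then show ?thesis using gn that(2) unfolding generalized_niederreiter_def by blast
    qed
  qed (use fin deg in auto)
  have b: "?b \<ge> 2" by (rule card_field_ge_2)
  have B: "?b ^ degree (p j) \<ge> 2" if "j \<in> u" for j
  proof -
    have "?b ^ 1 \<le> ?b ^ degree (p j)" using deg[OF that] b by (intro power_increasing) auto
    then show ?thesis using b by simp
  qed
  show "gain (\<lambda>j. ?b ^ degree (p j)) (niederreiter_point \<phi> p y) u k n \<ge> 0"
    by (intro gain_nonneg fin u(1) B)
  show "gain (\<lambda>j. ?b ^ degree (p j)) (niederreiter_point \<phi> p y) u k n \<le>
          (\<Prod>j\<in>u. real (?b ^ degree (p j)) / (real (?b ^ degree (p j)) - 1))"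
  proof (rule gain_le_prod[OF fin u(1) B n])
    show "0 \<le> niederreiter_point \<phi> p y i j \<and> niederreiter_point \<phi> p y i j < 1" if "j \<in> u" for i j
      unfolding niederreiter_point_def using digital_point_unit[OF \<phi> reg] u that by blast
  next
    fix i i'
    define m where "m = (\<Sum>j\<in>u. degree (p j) * (k j + 1))"
    assume "i div (\<Prod>j\<in>u. (?b ^ degree (p j)) ^ (k j + 1)) = i' div (\<Prod>j\<in>u. (?b ^ degree (p j)) ^ (k j + 1))"
    then have block: "i div ?b ^ m = i' div ?b ^ m"
      by (simp only: m_def power_sum power_mult)
    assume cell: "\<lfloor>real (?b ^ degree (p j)) ^ (k j + 1) * niederreiter_point \<phi> p y i j\<rfloor> =
          \<lfloor>real (?b ^ degree (p j)) ^ (k j + 1) * niederreiter_point \<phi> p y i' j\<rfloor>" if "j \<in> u" for j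
    \<comment> \<open>a common range of summation for the digit vectors of both indices\<close>
    define W where "W = Max {i, i', m}"
    have W: "i \<le> W" "i' \<le> W" "m \<le> W" by (auto simp: W_def)
    have "digit_vec \<phi> i r - digit_vec \<phi> i' r = 0" if "r \<in> {1..m}" for r
    proof (rule columns_independent[of "\<lambda>j. k j + 1", folded m_def, OF _ that])
      fix j l assume j: "j \<in> u" and l: "l \<in> {1..degree (p j) * (k j + 1)}"
      have "\<lfloor>real ?b ^ (degree (p j) * (k j + 1)) * digital_point \<phi> ?C i j\<rfloor> =
            \<lfloor>real ?b ^ (degree (p j) * (k j + 1)) * digital_point \<phi> ?C i' j\<rfloor>"
        using cell[OF j] unfolding niederreiter_point_def power_mult of_nat_power .
      then have "mat_digit_vec \<phi> (?C j) i l = mat_digit_vec \<phi> (?C j) i' l"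
        using l j u by (intro mat_digit_vec_eq_if_floor_eq[OF \<phi> reg]) auto
      then have "(\<Sum>r = 1..W. ?C j l r * (digit_vec \<phi> i r - digit_vec \<phi> i' r)) = 0"
        using W mat_digit_vec_eq_sum[OF \<phi>]
        by (simp add: right_diff_distrib sum_subtractf)
      moreover have "(\<Sum>r = 1..W. ?C j l r * (digit_vec \<phi> i r - digit_vec \<phi> i' r)) =
                     (\<Sum>r = 1..m. ?C j l r * (digit_vec \<phi> i r - digit_vec \<phi> i' r))"
        using W digit_vec_eq_if_div_eq[OF \<phi> block] by (intro sum.mono_neutral_right) auto
      ultimately show "(\<Sum>r = 1..m. ?C j l r * (digit_vec \<phi> i r - digit_vec \<phi> i' r)) = 0" by simp
    qed
    then show "i = i'"
      by (intro digits_determine_index[OF \<phi> block]) auto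
  qed
qed

section \<open>Counting irreducible polynomials over a finite field\<close>

lemma card_polys_degree_less:
  assumes "n > 0"
  shows "finite {f :: 'a :: {field, finite} poly. degree f < n}"
    and "card {f :: 'a :: {field, finite} poly. degree f < n} = CARD('a) ^ n"
proof -
  define A where "A = (\<lambda>n. {f :: 'a poly. \<forall>i\<ge>n. coeff f i = 0})"
  have "finite (A n) \<and> card (A n) = CARD('a) ^ n" for n
  proof (induction n)
    case 0
    have "A 0 = {0}" by (auto simp: A_def poly_eq_iff)
    then show ?case by simp
  next
    case (Suc n)
    have "A (Suc n) = (\<lambda>(a, f). pCons a f) ` (UNIV \<times> A n)"
    proof (intro equalityI subsetI)
      fix f assume "f \<in> A (Suc n)"
      moreover obtain a g where "f = pCons a g" by (cases f)
      ultimately have "(a, g) \<in> UNIV \<times> A n" "f = (\<lambda>(a, f). pCons a f) (a, g)"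
        unfolding A_def by (auto dest: spec[of _ "Suc _"])
      then show "f \<in> (\<lambda>(a, f). pCons a f) ` (UNIV \<times> A n)" by (rule rev_image_eqI)
    qed (auto simp: A_def coeff_pCons split: nat.splits)
    moreover have "inj_on (\<lambda>(a, f). pCons a f) (UNIV \<times> A n)" by (auto simp: inj_on_def)
    ultimately show ?case using Suc by (simp add: card_image)
  qed
  moreover have "{f :: 'a poly. degree f < n} = A n"
  proof (intro equalityI subsetI)
    fix f :: "'a poly" assume "f \<in> A n"
    then have "degree f \<le> n - 1" unfolding A_def by (intro degree_le) auto
    then show "f \<in> {f. degree f < n}" using assms by simp
  qed (auto simp: A_def intro: coeff_eq_0)
  ultimately show "finite {f :: 'a poly. degree f < n}"
    "card {f :: 'a poly. degree f < n} = CARD('a) ^ n" by simp_all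
qed

lemma irreducible_degree_pos: "irreducible (f :: 'a :: field poly) \<Longrightarrow> degree f > 0"
  using is_unit_iff_degree[of f] by (auto simp: irreducible_def)

text \<open>
  Fermat's little theorem in the field \<open>F[x]/(f)\<close> for the class of \<open>x\<close>: multiplication by a
  nonzero class permutes the nonzero classes, and comparing the products of all of them gives
  \<open>x ^ (b ^ e - 1) = 1\<close>.
\<close>

lemma irreducible_dvd_monom_diff:
  fixes f :: "'a :: {field, finite} poly"
  assumes irr: "irreducible f"
  shows "f dvd monom 1 (CARD('a) ^ degree f) - monom 1 1"
proof -
  define e where "e = degree f"
  define x :: "'a poly" where "x = monom 1 1"
  define S where "S = {g :: 'a poly. degree g < e} - {0}"
  have prime: "prime_elem f" using irr by (rule field_poly_irreducible_imp_prime)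
  have e: "e > 0" unfolding e_def by (rule irreducible_degree_pos[OF irr])
  have N: "CARD('a) ^ e = Suc (card S)"
    using card_polys_degree_less[OF e, where 'a = 'a] e unfolding S_def by (simp add: card_Diff_subset)
  have monom: "monom 1 (Suc n) - x = x * (x ^ n - 1)" for n
    by (simp add: x_def algebra_simps monom_power mult_monom)
  have fS: "\<not> f dvd g" if "g \<in> S" for g
    using that dvd_imp_degree_le[of f g] unfolding S_def e_def by auto
  have "f dvd x * (x ^ card S - 1)"
  proof (cases "f dvd x")
    case False
    \<comment> \<open>\<open>h\<close> is multiplication by the class of \<open>x\<close>, on representatives of degree less than \<open>e\<close>\<close>
    define h where "h = (\<lambda>g. (x * g) mod f)"
    have finS: "finite S" unfolding S_def using card_polys_degree_less(1)[OF e] by simp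
    have not_dvd: "\<not> f dvd x * g" if "g \<in> S" for g
      using fS[OF that] False prime_elem_dvd_multD[OF prime] by blast
    have "h ` S \<subseteq> S"
    proof (rule image_subsetI)
      fix g assume "g \<in> S"
      then have "\<not> f dvd x * g" by (rule not_dvd)
      moreover from this have "degree (h g) < e" unfolding h_def e_def
        using prime by (intro degree_mod_less_degree) auto
      ultimately show "h g \<in> S" by (simp add: S_def h_def mod_eq_0_iff_dvd)
    qed
    moreover have "inj_on h S"
    proof (rule inj_onI)
      fix g g' assume g: "g \<in> S" "g' \<in> S" and "h g = h g'"
      then have "f dvd x * (g - g')" by (simp add: h_def mod_eq_dvd_iff right_diff_distrib)
      then have "f dvd g - g'" using False prime_elem_dvd_multD[OF prime] by blast
      moreover have "degree (g - g') < e" using g degree_diff_less[of g e g'] by (auto simp: S_def)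
      ultimately show "g = g'" using dvd_imp_degree_le[of f "g - g'"] unfolding e_def by fastforce
    qed
    ultimately have "bij_betw h S S"
      unfolding bij_betw_def using endo_inj_surj[OF finS] by blast
    then have "(\<Prod>g\<in>S. h g) = (\<Prod>g\<in>S. g)" by (rule prod.reindex_bij_betw)
    then have "(\<Prod>g\<in>S. x * g) mod f = (\<Prod>g\<in>S. g) mod f"
      using mod_prod_eq[of "\<lambda>g. x * g" f S] by (simp add: h_def)
    then have "f dvd x ^ card S * (\<Prod>g\<in>S. g) - (\<Prod>g\<in>S. g)"
      by (simp add: mod_eq_dvd_iff prod.distrib)
    also have "x ^ card S * (\<Prod>g\<in>S. g) - (\<Prod>g\<in>S. g) = (x ^ card S - 1) * (\<Prod>g\<in>S. g)"
      by (simp add: algebra_simps)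
    finally have "f dvd (x ^ card S - 1) * (\<Prod>g\<in>S. g)" .
    moreover have "\<not> f dvd (\<Prod>g\<in>S. g)"
    proof -
      have "\<not> f dvd (\<Prod>g\<in>T. g)" if "finite T" "T \<subseteq> S" for T
        using that
      proof (induction T rule: finite_induct)
        case empty
        then show ?case using prime_elem_not_unit[OF prime] by simp
      next
        case (insert g T)
        then show ?case using fS by (simp add: prime_elem_dvd_mult_iff[OF prime])
      qed
      then show ?thesis using finS by blast
    qed
    ultimately have "f dvd x ^ card S - 1" using prime_elem_dvd_multD[OF prime] by blast
    then show ?thesis by simp
  qed simp
  then show ?thesis using monom[of "card S"] unfolding x_def N[symmetric] e_def by simp
qed

lemma monic_irreducible_dvd_imp_eq:
  fixes f g :: "'a :: field poly"
  assumes "irreducible f" "irreducible g" "lead_coeff f = 1" "lead_coeff g = 1" "f dvd g"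
  shows "f = g"
proof -
  obtain h where g: "g = f * h" using assms(5) by (elim dvdE)
  have "\<not> is_unit f" using assms(1) by (simp add: irreducible_def)
  then have "is_unit h" using irreducibleD[OF assms(2) g] by blast
  then obtain c where c: "h = [:c:]" by (auto simp: is_unit_poly_iff)
  have "lead_coeff g = lead_coeff f * lead_coeff h" by (simp only: g lead_coeff_mult)
  then have "c = 1" using assms(3,4) c by simp
  then show ?thesis using g c by simp
qed

lemma prod_monic_irreducibles_dvd:
  fixes A :: "'a :: field poly set"
  assumes "finite A" and "\<And>f. f \<in> A \<Longrightarrow> irreducible f \<and> lead_coeff f = 1 \<and> f dvd h"
  shows "\<Prod>A dvd h"
  using assms
proof (induction A rule: finite_induct)
  case (insert f A)
  have f: "irreducible f" "lead_coeff f = 1" "f dvd h" using insert.prems by auto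
  have prime: "prime_elem f" using f(1) by (rule field_poly_irreducible_imp_prime)
  obtain h' where h: "h = \<Prod>A * h'" using insert by (metis dvdE insertCI)
  have "\<not> f dvd \<Prod>T" if "finite T" "T \<subseteq> A" for T
    using that
  proof (induction T rule: finite_induct)
    case empty
    then show ?case using prime_elem_not_unit[OF prime] by simp
  next
    case (insert g T)
    have "irreducible g" "lead_coeff g = 1" using insert \<open>\<And>f'. f' \<in> insert f A \<Longrightarrow> _\<close> by auto
    then have "\<not> f dvd g"
      using monic_irreducible_dvd_imp_eq[of f g] f insert \<open>f \<notin> A\<close> by auto
    then show ?case using insert by (simp add: prime_elem_dvd_mult_iff[OF prime])
  qed
  then have "\<not> f dvd \<Prod>A" using insert by blast
  then have "f dvd h'" using f(3) prime_elem_dvd_multD[OF prime] unfolding h by blast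
  then show ?case using insert.hyps by (simp add: h mult.commute mult_dvd_mono)
qed simp

lemma prod_degrees:
  fixes A :: "'a :: field poly set"
  assumes "finite A" "\<And>f. f \<in> A \<Longrightarrow> f \<noteq> 0"
  shows "degree (\<Prod>A) = (\<Sum>f\<in>A. degree f)"
  using degree_prod_eq_sum_degree[of A "\<lambda>f. f"] assms by simp

text \<open>
  All irreducible polynomials of degree \<open>e\<close> and all linear ones divide \<open>x ^ (b ^ e) - x\<close>, so the sum of their
  degrees is at most \<open>b ^ e\<close>. The linear factors are worth keeping: the saving of \<open>b\<close> is what makes the
  numerical estimate below succeed for \<open>b = 2\<close>.
\<close>

lemma card_irreducibles_of_degree:
  fixes A :: "'a :: {field, finite} poly set"
  assumes fin: "finite A" and A: "\<And>f. f \<in> A \<Longrightarrow> irreducible f \<and> lead_coeff f = 1 \<and> degree f = e"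
    and e: "e \<ge> 2"
  shows "e * card A + CARD('a) \<le> CARD('a) ^ e"
proof -
  define lin where "lin = (\<lambda>a :: 'a. [:- a, 1:]) ` UNIV"
  define h :: "'a poly" where "h = monom 1 (CARD('a) ^ e) - monom 1 1"
  have fermat: "a ^ CARD('a) = a" for a :: 'a
  proof -
    have "[:- a, 1:] dvd monom 1 (CARD('a) ^ degree [:- a, 1:]) - monom 1 1"
      by (intro irreducible_dvd_monom_diff irreducible_linear_field_poly) simp
    then show ?thesis by (simp add: poly_eq_0_iff_dvd[symmetric] poly_monom)
  qed
  have "a ^ (CARD('a) ^ n) = a" for a :: 'a and n
    by (induction n) (simp_all add: power_mult fermat)
  then have lin_dvd: "f dvd h" if "f \<in> lin" for f
    using that by (auto simp: lin_def h_def poly_eq_0_iff_dvd[symmetric] poly_monom)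
  have disj: "A \<inter> lin = {}" using A e by (fastforce simp: lin_def)
  have card_lin: "card lin = CARD('a)" unfolding lin_def by (intro card_image) (auto simp: inj_on_def)
  have "CARD('a) ^ 1 < CARD('a) ^ e"
    using card_field_ge_2[where 'a = 'a] e by (intro power_strict_increasing) auto
  moreover from this have "1 < CARD('a) ^ e" using card_field_ge_2[where 'a = 'a] by simp
  ultimately have deg_h: "degree h = CARD('a) ^ e"
    unfolding h_def using degree_add_eq_left[of "- monom 1 1 :: 'a poly" "monom 1 (CARD('a) ^ e)"]
    by (simp add: degree_monom_eq)
  then have "h \<noteq> 0" by auto
  have irr: "irreducible f \<and> lead_coeff f = 1 \<and> f dvd h" if "f \<in> A \<union> lin" for f
  proof (cases "f \<in> A")
    case True
    have "f dvd h" using A[OF True] irreducible_dvd_monom_diff[of f] by (simp add: h_def)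
    then show ?thesis using A[OF True] by blast
  next
    case False
    then have "f \<in> lin" using that by blast
    then show ?thesis using lin_dvd by (auto simp: lin_def intro: irreducible_linear_field_poly)
  qed
  have finAL: "finite (A \<union> lin)" using fin by (simp add: lin_def)
  have "\<Prod>(A \<union> lin) dvd h" by (rule prod_monic_irreducibles_dvd[OF finAL irr])
  then have "degree (\<Prod>(A \<union> lin)) \<le> degree h" using \<open>h \<noteq> 0\<close> by (rule dvd_imp_degree_le)
  also have "degree (\<Prod>(A \<union> lin)) = (\<Sum>f\<in>A \<union> lin. degree f)"
    by (rule prod_degrees[OF finAL]) (use irr in \<open>auto simp: irreducible_def\<close>)
  also have "\<dots> = (\<Sum>f\<in>A. degree f) + (\<Sum>f\<in>lin. degree f)"
    using fin disj by (intro sum.union_disjoint) (auto simp: lin_def)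
  also have "(\<Sum>f\<in>A. degree f) = e * card A" using A by simp
  also have "(\<Sum>f\<in>lin. degree f) = (\<Sum>f\<in>lin. 1)" by (intro sum.cong) (auto simp: lin_def)
  also have "(\<Sum>f\<in>lin. 1) = CARD('a)" using card_lin by simp
  finally show ?thesis unfolding deg_h .
qed

lemma card_linear_monic:
  fixes A :: "'a :: {field, finite} poly set"
  assumes A: "\<And>f. f \<in> A \<Longrightarrow> lead_coeff f = 1 \<and> degree f = 1"
  shows "card A \<le> CARD('a)"
proof -
  have "A \<subseteq> (\<lambda>a :: 'a. [:a, 1:]) ` UNIV"
  proof
    fix f assume "f \<in> A"
    then have "lead_coeff f = 1" "degree f = 1" using A by blast+
    from degree1_coeffs[OF \<open>degree f = 1\<close>] obtain a c where "f = [:a, c:]" "c \<noteq> 0" by metis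
    with \<open>lead_coeff f = 1\<close> have "f = [:a, 1:]" by simp
    then show "f \<in> (\<lambda>a. [:a, 1:]) ` UNIV" by blast
  qed
  then have "card A \<le> card ((\<lambda>a :: 'a. [:a, 1:]) ` UNIV)" by (intro card_mono) auto
  also have "\<dots> \<le> CARD('a)" by (rule card_image_le) simp
  finally show ?thesis .
qed

section \<open>Partial Euler products over irreducible polynomials\<close>

text \<open>
  The passage from \<open>b\<close> to \<open>b + 1\<close> is Bernoulli's inequality for \<open>(1 + 1 / (b\<^sup>2 - 1)) ^ b\<close>.
\<close>

lemma inverse_power_factor_decreasing:
  assumes "(2::nat) \<le> c" "c \<le> b"
  shows "(real b / (real b - 1)) ^ b \<le> (real c / (real c - 1)) ^ c"
  using assms(2)
proof (induction b rule: nat_induct_at_least)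
  case (Suc b)
  have b: "b \<ge> 2" using assms Suc by simp
  define t where "t = 1 / (real b ^ 2 - 1)"
  have b2: "real b ^ 2 > 1" using b by (simp add: one_less_power)
  have "t \<ge> 0" using b2 by (simp add: t_def)
  have "real (Suc b) / real b \<le> 1 + real b * t"
  proof -
    have "1 / real b \<le> real b / (real b ^ 2 - 1)"
      using b b2 by (simp add: field_simps power2_eq_square)
    then show ?thesis using b by (simp add: t_def field_simps)
  qed
  also have "\<dots> \<le> (1 + t) ^ b" by (rule Bernoulli_inequality) (use \<open>t \<ge> 0\<close> in simp)
  finally have *: "real (Suc b) / real b \<le> (1 + t) ^ b" .
  have "(real (Suc b) / real b) ^ Suc b = (real (Suc b) / real b) ^ b * (real (Suc b) / real b)" by simp
  also have "\<dots> \<le> (real (Suc b) / real b) ^ b * (1 + t) ^ b"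
    by (intro mult_left_mono *) simp
  also have "\<dots> = (real (Suc b) / real b * (1 + t)) ^ b" by (rule power_mult_distrib[symmetric])
  also have "real (Suc b) / real b * (1 + t) = real b / (real b - 1)"
  proof -
    have "real b ^ 2 - 1 = (real b - 1) * (real b + 1)" by (simp add: power2_eq_square algebra_simps)
    then have "1 + t = real b ^ 2 / ((real b - 1) * (real b + 1))"
      using b2 by (simp add: t_def field_simps)
    moreover have "(x + 1) / x * (x\<^sup>2 / ((x - 1) * (x + 1))) = x / (x - 1)" if "x > 1" for x :: real
    proof -
      have "x \<noteq> 0" "x - 1 \<noteq> 0" "x + 1 \<noteq> 0" using that by auto
      then show ?thesis by (simp add: power2_eq_square)
    qed
    ultimately show ?thesis using b by (simp add: add.commute)
  qed
  finally show ?case using Suc.IH by simp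
qed simp

lemma harmonic_tail_le:
  assumes "(4::nat) \<le> N"
  shows "(\<Sum>e = 5..N. 1 / real e) \<le> ln (real N / 4)"
  using assms
proof (induction N rule: nat_induct_at_least)
  case (Suc N)
  have "ln (real N / real (Suc N)) \<le> real N / real (Suc N) - 1"
    by (rule ln_le_minus_one) (use Suc in simp)
  also have "\<dots> = - (1 / real (Suc N))" by (simp add: field_simps)
  finally have "ln (real N / 4) + 1 / real (Suc N) \<le> ln (real (Suc N) / 4)"
    using Suc by (simp add: ln_div)
  then show ?case using Suc by simp
qed simp

text \<open>
  An upper bound for the logarithm of what all irreducible polynomials of degree \<open>e \<ge> 2\<close> together
  contribute to the Euler product: there are at most \<open>(b ^ e - b) / e\<close> of them, each
  contributing at most \<open>1 / (b ^ e - 1)\<close>.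
\<close>

definition degree_weight :: "nat \<Rightarrow> nat \<Rightarrow> real" where
  "degree_weight b e = (real b ^ e - real b) / (real e * (real b ^ e - 1))"

lemma degree_weight_le:
  assumes "b \<ge> 2" "e \<ge> 2"
  shows "degree_weight b e \<le> 1 / real e"
proof -
  have "real b ^ e > 1" using assms by (simp add: one_less_power)
  then show ?thesis using assms unfolding degree_weight_def by (simp add: field_simps)
qed

text \<open>
  The weights of degree 5 and more are compared with the harmonic series and give the factor
  \<open>N / 4\<close>. The rest is a numerical inequality at \<open>N = 4\<close>. For \<open>b = 2\<close> the exponent is at most
  \<open>1/3 + 2/7 + 7/30 + 4/31 < 1\<close> and the first factor is 4. For \<open>b \<ge> 3\<close> the exponent is at most
  \<open>1/2 + 1/3 + 1/4 + 1/26 = 1 + 19/156\<close> and the first factor at most \<open>27/8\<close>.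
\<close>

lemma euler_bound_le_linear:
  assumes b: "(b::nat) \<ge> 2" and N: "(N::nat) \<ge> 4" and d: "(d::nat) < b ^ (N - 2)"
  shows "(real b / (real b - 1)) ^ b *
           exp ((\<Sum>e = 2..N. degree_weight b e) + real d / (real b ^ (N + 1) - 1)) \<le> exp 1 * real N"
proof -
  define w where "w = degree_weight b 2 + degree_weight b 3 + degree_weight b 4"
  define \<delta> where "\<delta> = real d / (real b ^ (N + 1) - 1)"
  define z where "z = real b ^ (N - 2)"
  have z: "real b ^ (N + 1) = real b ^ 3 * z" unfolding z_def using N by (simp flip: power_add)
  have dz: "real d \<le> z" using d unfolding z_def by (metis less_imp_le of_nat_le_iff of_nat_power)
  have z_ge: "z \<ge> real b ^ 2" unfolding z_def using b N by (intro power_increasing) auto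
  have "{2..N} = {2, 3, 4} \<union> {5..N}" using N by auto
  then have "(\<Sum>e = 2..N. degree_weight b e) = w + (\<Sum>e = 5..N. degree_weight b e)"
    by (simp add: sum.union_disjoint w_def)
  also have "(\<Sum>e = 5..N. degree_weight b e) \<le> (\<Sum>e = 5..N. 1 / real e)"
    by (intro sum_mono degree_weight_le b) auto
  also have "\<dots> \<le> ln (real N / 4)" by (rule harmonic_tail_le[OF N])
  finally have sum_le: "(\<Sum>e = 2..N. degree_weight b e) \<le> w + ln (real N / 4)" by simp
  have main: "(real b / (real b - 1)) ^ b * exp (w + \<delta>) \<le> 4 * exp 1"
  proof (cases "b = 2")
    case True
    have "\<delta> \<le> z / (8 * z - 1)" unfolding \<delta>_def z
      using True dz z_ge by (intro frac_le) auto
    also have "\<dots> \<le> 4 / 31" using z_ge True by (simp add: field_simps)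
    finally have "\<delta> \<le> 4 / 31" .
    moreover have "w = 1 / 3 + 2 / 7 + 7 / 30"
      unfolding w_def degree_weight_def True by simp
    ultimately have "exp (w + \<delta>) \<le> exp 1" by simp
    then show ?thesis using True by simp
  next
    case False
    then have b3: "b \<ge> 3" using b by simp
    have b3': "real b ^ 3 \<ge> 27" using power_mono[of 3 "real b" 3] b3 by simp
    have "z \<ge> 9" using z_ge power_mono[of 3 "real b" 2] b3 by simp
    have "\<delta> \<le> z / (27 * z - 1)" unfolding \<delta>_def z
      using dz \<open>z \<ge> 9\<close> b3' by (intro frac_le diff_right_mono mult_right_mono) auto
    also have "\<dots> \<le> 1 / 26" using \<open>z \<ge> 9\<close> by (simp add: field_simps)
    finally have "\<delta> \<le> 1 / 26" .
    moreover have "w \<le> 1 / 2 + 1 / 3 + 1 / 4"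
      unfolding w_def using degree_weight_le[OF b, of 2] degree_weight_le[OF b, of 3]
        degree_weight_le[OF b, of 4] by simp
    ultimately have "exp (w + \<delta>) \<le> exp (1 + 19 / 156)" by simp
    also have "\<dots> = exp 1 * exp (19 / 156)" by (rule exp_add)
    also have "exp (19 / 156 :: real) \<le> 156 / 137"
    proof -
      have "1 + (- (19 / 156)) \<le> exp (- (19 / 156) :: real)" by (rule exp_ge_add_one_self)
      then show ?thesis by (simp add: exp_minus field_simps)
    qed
    finally have *: "exp (w + \<delta>) \<le> exp 1 * (156 / 137)" by simp
    have **: "(real b / (real b - 1)) ^ b \<le> 27 / 8"
      using inverse_power_factor_decreasing[of 3 b] b3 by (simp add: power3_eq_cube)
    have "(real b / (real b - 1)) ^ b * exp (w + \<delta>) \<le> 27 / 8 * (exp 1 * (156 / 137))"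
      by (intro mult_mono * **) auto
    also have "\<dots> \<le> 4 * exp 1" by simp
    finally show ?thesis .
  qed
  have "(real b / (real b - 1)) ^ b * exp ((\<Sum>e = 2..N. degree_weight b e) + \<delta>) \<le>
        (real b / (real b - 1)) ^ b * exp ((w + \<delta>) + ln (real N / 4))"
    using sum_le b by (intro mult_left_mono) auto
  also have "\<dots> = ((real b / (real b - 1)) ^ b * exp (w + \<delta>)) * (real N / 4)"
    using N by (simp add: exp_add exp_ln mult.assoc del: ln_div)
  also have "\<dots> \<le> (4 * exp 1) * (real N / 4)"
    by (intro mult_right_mono main) simp
  finally show ?thesis by (simp add: \<delta>_def)
qed

text \<open>
  Mertens' estimate for polynomials. Linear polynomials contribute at most \<open>b\<close> factors
  \<open>b / (b - 1)\<close>, the degrees from 2 to \<open>N\<close> contribute their weights, and each of the at most \<open>card A\<close>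
  remaining factors is at most \<open>1 + 1 / (b ^ (N + 1) - 1)\<close>.
\<close>

lemma prod_irreducibles_le:
  fixes A :: "'a :: {field, finite} poly set"
  assumes fin: "finite A" and A: "\<And>f. f \<in> A \<Longrightarrow> irreducible f \<and> lead_coeff f = 1"
    and N: "N \<ge> 1"
  defines "b \<equiv> CARD('a)"
  shows "(\<Prod>f\<in>A. real (b ^ degree f) / (real (b ^ degree f) - 1)) \<le>
           (real b / (real b - 1)) ^ b *
           exp ((\<Sum>e = 2..N. degree_weight b e) + real (card A) / (real b ^ (N + 1) - 1))"
proof -
  define q where "q = (\<lambda>e. real b ^ e / (real b ^ e - 1))"
  define A1 where "A1 = {f \<in> A. degree f \<le> N}"
  define A2 where "A2 = {f \<in> A. degree f > N}"
  have b: "b \<ge> 2" unfolding b_def by (rule card_field_ge_2)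
  have pow: "real b ^ e > 1" if "e \<ge> 1" for e
    using b that by (simp add: one_less_power)
  have q_ge1: "q e \<ge> 1" and q_exp: "q e \<le> exp (1 / (real b ^ e - 1))" if "e \<ge> 1" for e
  proof -
    have q: "q e = 1 + 1 / (real b ^ e - 1)" using pow[OF that] by (simp add: q_def field_simps)
    show "q e \<ge> 1" using q pow[OF that] by simp
    show "q e \<le> exp (1 / (real b ^ e - 1))" unfolding q by (rule exp_ge_add_one_self)
  qed
  have deg: "degree f \<ge> 1" if "f \<in> A" for f
    using irreducible_degree_pos[of f] A[OF that] by simp
  have level: "(\<Prod>f\<in>{f \<in> A1. degree f = e}. q (degree f)) \<le>
               (if e = 1 then (real b / (real b - 1)) ^ b else exp (degree_weight b e))"
    if e: "e \<in> {1..N}" for e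
  proof -
    define Ae where "Ae = {f \<in> A1. degree f = e}"
    have Ae: "irreducible f \<and> lead_coeff f = 1 \<and> degree f = e" if "f \<in> Ae" for f
      using that A by (auto simp: Ae_def A1_def)
    have prod: "(\<Prod>f\<in>Ae. q (degree f)) = q e ^ card Ae"
      using Ae by simp
    have "q e ^ card Ae \<le> (if e = 1 then (real b / (real b - 1)) ^ b else exp (degree_weight b e))"
    proof (cases "e = 1")
      case True
      have "card Ae \<le> b" unfolding b_def
        by (rule card_linear_monic) (use Ae[unfolded True] in blast)
      then have "q 1 ^ card Ae \<le> q 1 ^ b" using q_ge1[of 1] by (intro power_increasing) auto
      then show ?thesis using True by (simp add: q_def)
    next
      case False
      then have e2: "e \<ge> 2" using e by simp
      have "finite Ae" using fin by (simp add: Ae_def A1_def)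
      then have "e * card Ae + b \<le> b ^ e"
        unfolding b_def using Ae e2 by (intro card_irreducibles_of_degree) auto
      then have "real e * real (card Ae) \<le> real b ^ e - real b"
        by (metis le_diff_eq of_nat_add of_nat_le_iff of_nat_mult of_nat_power)
      then have "real (card Ae) \<le> (real b ^ e - real b) / real e"
        using e2 by (simp add: pos_le_divide_eq mult.commute)
      then have "real (card Ae) / (real b ^ e - 1) \<le> (real b ^ e - real b) / real e / (real b ^ e - 1)"
        using e2 pow[of e] by (intro divide_right_mono) auto
      then have "real (card Ae) / (real b ^ e - 1) \<le> degree_weight b e"
        unfolding degree_weight_def by simp
      moreover have "q e ^ card Ae \<le> exp (1 / (real b ^ e - 1)) ^ card Ae"
        using q_exp[of e] q_ge1[of e] e2 by (intro power_mono) auto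
      moreover have "exp (1 / (real b ^ e - 1)) ^ card Ae = exp (real (card Ae) / (real b ^ e - 1))"
        by (simp flip: exp_of_nat_mult)
      ultimately show ?thesis using False by (smt (verit) exp_le_cancel_iff)
    qed
    then show ?thesis using prod unfolding Ae_def by simp
  qed
  have low: "(\<Prod>f\<in>A1. q (degree f)) \<le>
             (real b / (real b - 1)) ^ b * exp (\<Sum>e = 2..N. degree_weight b e)"
  proof -
    have "(\<Prod>f\<in>A1. q (degree f)) = (\<Prod>e\<in>{1..N}. \<Prod>f\<in>{f \<in> A1. degree f = e}. q (degree f))"
      by (rule prod.group[symmetric]) (use fin deg in \<open>auto simp: A1_def\<close>)
    also have "\<dots> \<le> (\<Prod>e\<in>{1..N}. if e = 1 then (real b / (real b - 1)) ^ b else exp (degree_weight b e))"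
    proof (intro prod_mono conjI level prod_nonneg)
      fix e f assume "f \<in> {f \<in> A1. degree f = e}"
      then show "q (degree f) \<ge> 0" using q_ge1[of "degree f"] deg[of f] by (auto simp: A1_def)
    qed
    also have "{1..N} = insert 1 {2..N}" using N by auto
    also have "(\<Prod>e\<in>insert 1 {2..N}. if e = 1 then (real b / (real b - 1)) ^ b else exp (degree_weight b e))
             = (real b / (real b - 1)) ^ b * (\<Prod>e\<in>{2..N}. exp (degree_weight b e))"
      by simp
    also have "(\<Prod>e\<in>{2..N}. exp (degree_weight b e)) = exp (\<Sum>e = 2..N. degree_weight b e)"
      by (simp add: exp_sum)
    finally show ?thesis .
  qed
  have high: "(\<Prod>f\<in>A2. q (degree f)) \<le> exp (real (card A) / (real b ^ (N + 1) - 1))"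
  proof -
    have "(\<Prod>f\<in>A2. q (degree f)) \<le> exp (1 / (real b ^ (N + 1) - 1)) ^ card A"
    proof (rule prod_le_power)
      fix f assume f: "f \<in> A2"
      then have "N + 1 \<le> degree f" by (simp add: A2_def)
      then have "real b ^ (N + 1) \<le> real b ^ degree f" using b by (intro power_increasing) auto
      then have "1 / (real b ^ degree f - 1) \<le> 1 / (real b ^ (N + 1) - 1)"
        using pow[of "N + 1"] by (intro divide_left_mono) (auto intro: mult_pos_pos)
      then show "0 \<le> q (degree f) \<and> q (degree f) \<le> exp (1 / (real b ^ (N + 1) - 1))"
        using q_ge1[of "degree f"] q_exp[of "degree f"] \<open>N + 1 \<le> degree f\<close>
        by (smt (verit) exp_le_cancel_iff le_add2 le_trans)
    next
      show "card A2 \<le> card A" using fin by (intro card_mono) (auto simp: A2_def)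
      show "exp (1 / (real b ^ (N + 1) - 1)) \<ge> 1" using pow[of "N + 1"] by simp
    qed
    then show ?thesis by (simp flip: exp_of_nat_mult)
  qed
  have "(\<Prod>f\<in>A. real (b ^ degree f) / (real (b ^ degree f) - 1)) = (\<Prod>f\<in>A1 \<union> A2. q (degree f))"
    by (rule prod.cong) (auto simp: q_def A1_def A2_def)
  also have "\<dots> = (\<Prod>f\<in>A1. q (degree f)) * (\<Prod>f\<in>A2. q (degree f))"
    by (rule prod.union_disjoint) (use fin in \<open>auto simp: A1_def A2_def\<close>)
  also have "\<dots> \<le> ((real b / (real b - 1)) ^ b * exp (\<Sum>e = 2..N. degree_weight b e)) *
                     exp (real (card A) / (real b ^ (N + 1) - 1))"
  proof (intro mult_mono low high prod_nonneg mult_nonneg_nonneg)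
    fix f assume "f \<in> A2"
    then show "q (degree f) \<ge> 0" using q_ge1[of "degree f"] deg[of f] by (auto simp: A2_def)
  qed (use b in auto)
  finally show ?thesis by (simp add: exp_add mult.assoc)
qed

text \<open>
  With \<open>N\<close> the rounded logarithmic expression, \<open>d < b ^ (N - 2)\<close>, because the iterated logarithm
  is positive. If \<open>N = 3\<close>, then there are fewer than \<open>b\<close> factors, each at most \<open>b / (b - 1)\<close>, and
  the product is at most \<open>4 < 3 * exp 1\<close>. Otherwise degrees up to \<open>N\<close> are separated from the larger ones.
\<close>

lemma prod_irreducibles_le_log:
  fixes A :: "'a :: {field, finite} poly set"
  assumes fin: "finite A" and A: "\<And>f. f \<in> A \<Longrightarrow> irreducible f \<and> lead_coeff f = 1"
    and d: "card A \<le> d" "d \<ge> 1"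
  defines "b \<equiv> CARD('a)"
  shows "(\<Prod>f\<in>A. real (b ^ degree f) / (real (b ^ degree f) - 1)) \<le>
     exp 1 * real_of_int \<lceil>log (real b) (real d) + log (real b) (log (real b) (real (d + b))) + 2\<rceil>"
proof -
  define t where "t = log (real b) (real d) + log (real b) (log (real b) (real (d + b)))"
  define N where "N = nat \<lceil>t + 2\<rceil>"
  have b: "b \<ge> 2" unfolding b_def by (rule card_field_ge_2)
  have "log (real b) (real b) < log (real b) (real (d + b))"
    using b d by (subst log_less_cancel_iff) auto
  then have "log (real b) (real (d + b)) > 1" using b by simp
  then have loglog: "log (real b) (log (real b) (real (d + b))) > 0" using b by simp
  have "log (real b) (real d) \<ge> 0" using b d by simp
  then have "t > 0" using loglog by (simp add: t_def)
  then have N: "real_of_int \<lceil>t + 2\<rceil> = real N" "N \<ge> 3" "t + 2 \<le> real N"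
    unfolding N_def by linarith+
  have "log (real b) (real d) < real (N - 2)" using N loglog unfolding t_def by simp
  then have "real d < real b ^ (N - 2)"
    using b d by (simp add: log_less_iff powr_realpow)
  then have d_less: "d < b ^ (N - 2)" by (metis of_nat_less_iff of_nat_power)
  have "(\<Prod>f\<in>A. real (b ^ degree f) / (real (b ^ degree f) - 1)) \<le> exp 1 * real N"
  proof (cases "N = 3")
    case True
    have "(\<Prod>f\<in>A. real (b ^ degree f) / (real (b ^ degree f) - 1)) \<le> (real b / (real b - 1)) ^ b"
    proof (rule prod_le_power)
      fix f assume "f \<in> A"
      then have "degree f \<ge> 1" using irreducible_degree_pos[of f] A by fastforce
      then have "real b ^ 1 \<le> real b ^ degree f" using b by (intro power_increasing) auto
      then have "real b \<le> real b ^ degree f" by simp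
      then have "real b ^ degree f / (real b ^ degree f - 1) \<le> real b / (real b - 1)"
      proof -
        have "1 / (real b ^ degree f - 1) \<le> 1 / (real b - 1)"
          using b \<open>real b \<le> real b ^ degree f\<close> by (intro frac_le) auto
        moreover have "c / (c - 1) = 1 + 1 / (c - 1)" if "c \<ge> real b" for c
          using that b by (simp add: field_simps)
        ultimately show ?thesis using \<open>real b \<le> real b ^ degree f\<close> by simp
      qed
      then show "0 \<le> real (b ^ degree f) / (real (b ^ degree f) - 1) \<and>
            real (b ^ degree f) / (real (b ^ degree f) - 1) \<le> real b / (real b - 1)"
        using \<open>real b \<le> real b ^ degree f\<close> b by simp
    next
      show "card A \<le> b" using d d_less True by simp
      show "real b / (real b - 1) \<ge> 1" using b by simp
    qed
    also have "\<dots> \<le> 4"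
      using inverse_power_factor_decreasing[of 2 b] b by simp
    also have "\<dots> \<le> exp 1 * real N"
      using True exp_ge_add_one_self[of 1] by simp
    finally show ?thesis .
  next
    case False
    then have "N \<ge> 4" using N by simp
    have "(\<Prod>f\<in>A. real (b ^ degree f) / (real (b ^ degree f) - 1)) \<le>
           (real b / (real b - 1)) ^ b *
           exp ((\<Sum>e = 2..N. degree_weight b e) + real (card A) / (real b ^ (N + 1) - 1))"
      unfolding b_def by (rule prod_irreducibles_le[OF fin A]) (use N in auto)
    also have "\<dots> \<le> exp 1 * real N"
      by (rule euler_bound_le_linear[OF b \<open>N \<ge> 4\<close>]) (use d d_less in simp)
    finally show ?thesis .
  qed
  then show ?thesis using N(1) unfolding t_def by simp
qed

section \<open>The maximal gain coefficient\<close>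

text \<open>
  The lower bound ensures that the supremum, read as a real number, is
  bounded in absolute value by its upper bound.
\<close>

lemma niederreiter_max_gain_bounds:
  fixes \<phi> :: "nat \<Rightarrow> 'a :: {field, finite}"
  assumes gn: "generalized_niederreiter \<phi> p y d" and d: "d \<ge> 1"
    and irred: "\<And>j. j \<in> {1..d} \<Longrightarrow> irreducible (p j)"
  defines "b \<equiv> CARD('a)"
  shows "0 \<le> niederreiter_max_gain \<phi> p y d"
    and "niederreiter_max_gain \<phi> p y d \<le> ereal (exp 1 * real_of_int
           \<lceil>log (real b) (real d) + log (real b) (log (real b) (real (d + b))) + 2\<rceil>)"
proof -
  let ?gain = "gain (\<lambda>j. CARD('a) ^ degree (p j)) (niederreiter_point \<phi> p y)"
  let ?bound = "exp 1 * real_of_int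
           \<lceil>log (real b) (real d) + log (real b) (log (real b) (real (d + b))) + 2\<rceil>"
  have fin: "finite {u. u \<noteq> {} \<and> u \<subseteq> {1..d}}" by simp
  have mem: "{1} \<in> {u. u \<noteq> {} \<and> u \<subseteq> {1..d}}" using d by simp
  have ne: "{u. u \<noteq> {} \<and> u \<subseteq> {1..d}} \<noteq> {}" using mem by blast
  have "0 \<le> ereal (?gain {1} (\<lambda>_. 0) 1)"
    using generalized_niederreiter_gain_bounds(1)[OF gn irred, of "{1}"] d by simp
  also have "\<dots> \<le> (SUP n\<in>{1..}. ereal (?gain {1} (\<lambda>_. 0) n))" by (rule SUP_upper) simp
  also have "\<dots> \<le> (SUP k. SUP n\<in>{1..}. ereal (?gain {1} k n))" by (rule SUP_upper) simp
  also have "\<dots> \<le> niederreiter_max_gain \<phi> p y d"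
    unfolding niederreiter_max_gain_def max_gain_def
    by (rule Max_ge) (use fin mem in auto)
  finally show "0 \<le> niederreiter_max_gain \<phi> p y d" .
  have gain_le: "?gain u k n \<le> ?bound" if u: "u \<noteq> {}" "u \<subseteq> {1..d}" and n: "n \<ge> 1" for u k n
  proof -
    have monic: "lead_coeff (p j) = 1" if "j \<in> {1..d}" for j
      using gn that unfolding generalized_niederreiter_def by blast
    have inj: "inj_on p u"
    proof (rule inj_onI, rule ccontr)
      fix i j assume ij: "i \<in> u" "j \<in> u" "p i = p j" "i \<noteq> j"
      have "i \<in> {1..d}" "j \<in> {1..d}" using ij u by auto
      then have "coprime (p i) (p j)"
        using gn ij(4) unfolding generalized_niederreiter_def by blast
      then have "is_unit (p j)" using ij(3) by simp
      then show False using irred[OF \<open>j \<in> {1..d}\<close>] by (simp add: irreducible_def)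
    qed
    have fin_u: "finite u" using u(2) by (rule finite_subset) simp
    have "?gain u k n \<le>
        (\<Prod>j\<in>u. real (CARD('a) ^ degree (p j)) / (real (CARD('a) ^ degree (p j)) - 1))"
      by (rule generalized_niederreiter_gain_bounds(2)[OF gn irred u]) (use n in auto)
    also have "\<dots> = (\<Prod>f\<in>p ` u. real (CARD('a) ^ degree f) / (real (CARD('a) ^ degree f) - 1))"
      using inj by (simp add: prod.reindex)
    also have "\<dots> \<le> ?bound"
      unfolding b_def
    proof (rule prod_irreducibles_le_log[OF _ _ _ d])
      show "irreducible f \<and> lead_coeff f = 1" if "f \<in> p ` u" for f
        using that irred monic u(2) by blast
      have "card u \<le> card {1..d}" by (intro card_mono u(2)) simp
      then show "card (p ` u) \<le> d" using inj by (simp add: card_image)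
    qed (use fin_u in simp)
    finally show ?thesis .
  qed
  show "niederreiter_max_gain \<phi> p y d \<le> ereal ?bound"
    unfolding niederreiter_max_gain_def max_gain_def
  proof (rule Max.boundedI)
    fix s assume "s \<in> (\<lambda>u. SUP k. SUP n\<in>{1..}. ereal (?gain u k n)) ` {u. u \<noteq> {} \<and> u \<subseteq> {1..d}}"
    then obtain u where u: "u \<noteq> {}" "u \<subseteq> {1..d}" and s: "s = (SUP k. SUP n\<in>{1..}. ereal (?gain u k n))"
      by blast
    show "s \<le> ereal ?bound" unfolding s
      by (intro SUP_least) (use gain_le[OF u] in simp)
  qed (use fin ne in auto)
qed

lemma log_bound_in_bigo_ln:
  fixes b :: nat
  assumes b: "b \<ge> 2"
  shows "(\<lambda>d. exp 1 * real_of_int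
           \<lceil>log (real b) (real d) + log (real b) (log (real b) (real (d + b))) + 2\<rceil>)
         \<in> O(\<lambda>d :: nat. ln (real d))"
proof -
  define l where "l = ln (real b)"
  have l: "l > 0" using b by (simp add: l_def)
  \<comment> \<open>the summand 3 instead of 2 absorbs the rounding\<close>
  have "(\<lambda>d. exp 1 * real_of_int
           \<lceil>log (real b) (real d) + log (real b) (log (real b) (real (d + b))) + 2\<rceil>)
        \<in> O(\<lambda>d :: nat. log (real b) (real d) + log (real b) (log (real b) (real (d + b))) + 3)"
  proof (rule bigoI[of _ "exp 1"], rule eventually_sequentiallyI[of 1])
    fix d :: nat assume d: "d \<ge> 1"
    have "log (real b) (real b) \<le> log (real b) (real (d + b))"
      using b by (subst log_le_cancel_iff) auto
    then have "log (real b) (log (real b) (real (d + b))) \<ge> 0" using b by simp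
    moreover have "log (real b) (real d) \<ge> 0" using b d by simp
    ultimately show "norm (exp 1 * real_of_int
           \<lceil>log (real b) (real d) + log (real b) (log (real b) (real (d + b))) + 2\<rceil>) \<le>
        exp 1 * norm (log (real b) (real d) + log (real b) (log (real b) (real (d + b))) + 3)"
      by (simp add: abs_mult) linarith
  qed
  also have "(\<lambda>d :: nat. log (real b) (real d) + log (real b) (log (real b) (real (d + b))) + 3)
       \<in> O(\<lambda>d :: nat. ln (real d))"
    unfolding log_def of_nat_add l_def[symmetric] using l b by real_asymp
  finally show ?thesis .
qed

theorem corollary3p8:
  fixes \<phi> :: "nat \<Rightarrow> 'a :: {field, finite}"
    and p :: "nat \<Rightarrow> 'a poly"
    and y :: "nat \<Rightarrow> nat \<Rightarrow> 'a poly"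
    and b :: nat
  assumes b: "b = CARD('a)"
    and base: "sobol_base p \<or> full_niederreiter_base p"
  shows "(\<forall>d\<ge>1. generalized_niederreiter \<phi> p y d \<longrightarrow>
            niederreiter_max_gain \<phi> p y d \<le>
              ereal (exp 1 * real_of_int
                \<lceil>log (real b) (real d) + log (real b) (log (real b) (real (d + b))) + 2\<rceil>)) \<and>
         ((\<forall>d\<ge>1. generalized_niederreiter \<phi> p y d) \<longrightarrow>
            (\<lambda>d. real_of_ereal (niederreiter_max_gain \<phi> p y d)) \<in> O(\<lambda>d. ln (real d)))"
proof -
  have irred: "irreducible (p j)" if "j \<ge> 1" for j
    using base
  proof
    assume "full_niederreiter_base p"
    then have "p j \<in> {f. lead_coeff f = 1 \<and> irreducible f}"
      using that unfolding full_niederreiter_base_def bij_betw_def by blast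
    then show ?thesis by simp
  next
    assume sobol: "sobol_base p"
    show ?thesis
    proof (cases "j = 1")
      case True
      then show ?thesis using sobol irreducible_linear_field_poly[of 1 0] by (simp add: sobol_base_def)
    next
      case False
      then have "p j \<in> {f. primitive_polynomial f}"
        using sobol that unfolding sobol_base_def bij_betw_def by auto
      then show ?thesis by (simp add: primitive_polynomial_def)
    qed
  qed
  note bounds = niederreiter_max_gain_bounds[where \<phi> = \<phi> and p = p and y = y, folded b]
  have bigo: "(\<lambda>d. real_of_ereal (niederreiter_max_gain \<phi> p y d)) \<in> O(\<lambda>d. ln (real d))"
    if gn: "\<forall>d\<ge>1. generalized_niederreiter \<phi> p y d"
  proof -
    have "(\<lambda>d. real_of_ereal (niederreiter_max_gain \<phi> p y d)) \<in> O(\<lambda>d. exp 1 * real_of_int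
           \<lceil>log (real b) (real d) + log (real b) (log (real b) (real (d + b))) + 2\<rceil>)"
    proof (rule bigoI[of _ 1], rule eventually_sequentiallyI[of 1])
      fix d :: nat assume d: "d \<ge> 1"
      have "0 \<le> niederreiter_max_gain \<phi> p y d"
        "niederreiter_max_gain \<phi> p y d \<le> ereal (exp 1 * real_of_int
           \<lceil>log (real b) (real d) + log (real b) (log (real b) (real (d + b))) + 2\<rceil>)"
        by (rule bounds; use gn d irred in simp)+
      then show "norm (real_of_ereal (niederreiter_max_gain \<phi> p y d)) \<le>
          1 * norm (exp 1 * real_of_int
           \<lceil>log (real b) (real d) + log (real b) (log (real b) (real (d + b))) + 2\<rceil>)"
        by (cases "niederreiter_max_gain \<phi> p y d") auto
    qed
    also have "(\<lambda>d. exp 1 * real_of_int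
           \<lceil>log (real b) (real d) + log (real b) (log (real b) (real (d + b))) + 2\<rceil>) \<in> O(\<lambda>d. ln (real d))"
      by (rule log_bound_in_bigo_ln) (simp add: b card_field_ge_2)
    finally show ?thesis .
  qed
  then show ?thesis using bounds(2) irred by auto
qed

end
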